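(* Let $m\ge 2$ be an integer and let $\mathcal{F}$ be a family of connected bipartite graphs, each having at least $m$ edges. Let $k_v^{\le m}$ be the number of graphs in $\mathcal{F}$ with at most $m$ vertices and $k_e^m$ the number of graphs in $\mathcal{F}$ with exactly $m$ edges. Then $$\chi_{2,\mathcal{F}}(\Delta) < (k_v^{\le m}+71)(m+1)\Delta^{\frac{m}{m-1}}$$ and $$\chi_{2,\mathcal{F}}(\Delta) < \left(k_e^m + 1 + o(1)\right)(m+1)\Delta^{\frac{m}{m-1}},$$ where $o(1)$ tends to $0$ as $\Delta\to\infty$.
   Context: A $(2,\mathcal{F})$-subgraph coloring of a graph $G$ is a proper vertex-coloring of $G$ such that, for any two color classes, the subgraph of $G$ induced by their union contains no subgraph isomorphic to any $H\in\mathcal{F}$. $\chi_{2,\mathcal{F}}(G)$ is the minimum number of colors of such a coloring, and $\chi_{2,\mathcal{F}}(\Delta)$ is the maximum of $\chi_{2,\mathcal{F}}(G)$ over all graphs $G$ with maximum degree at most $\Delta$. Graphs in $\mathcal{F}$ are counted up to isomorphism. *)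

theory Defs
  imports "HOL-Analysis.Analysis" "HOL-Library.Extended_Nat"
begin

text \<open>Finite simple graphs with natural-number vertices: a pair (V, E) where
  E is a set of 2-element subsets of V.  Every finite graph is isomorphic to one of these.\<close>

type_synonym graph = "nat set \<times> nat set set"

definition verts :: "graph \<Rightarrow> nat set" where "verts G = fst G"
definition edges :: "graph \<Rightarrow> nat set set" where "edges G = snd G"

definition wf_graph :: "graph \<Rightarrow> bool" where
  "wf_graph G \<longleftrightarrow> finite (verts G) \<and> (\<forall>e\<in>edges G. e \<subseteq> verts G \<and> card e = 2)"

definition degree :: "graph \<Rightarrow> nat \<Rightarrow> nat" where
  "degree G v = card {e \<in> edges G. v \<in> e}"

definition max_degree_le :: "graph \<Rightarrow> nat \<Rightarrow> bool" where
  "max_degree_le G \<Delta> \<longleftrightarrow> (\<forall>v\<in>verts G. degree G v \<le> \<Delta>)"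

definition adj :: "graph \<Rightarrow> nat \<Rightarrow> nat \<Rightarrow> bool" where
  "adj G u v \<longleftrightarrow> {u, v} \<in> edges G"

definition connected_graph :: "graph \<Rightarrow> bool" where
  "connected_graph G \<longleftrightarrow> verts G \<noteq> {} \<and> (\<forall>u\<in>verts G. \<forall>v\<in>verts G. (adj G)\<^sup>*\<^sup>* u v)"

definition bipartite :: "graph \<Rightarrow> bool" where
  "bipartite G \<longleftrightarrow> (\<exists>A \<subseteq> verts G. \<forall>e\<in>edges G. card (e \<inter> A) = 1)"

definition graph_iso :: "graph \<Rightarrow> graph \<Rightarrow> bool" where
  "graph_iso H H' \<longleftrightarrow> (\<exists>f. bij_betw f (verts H) (verts H') \<and> (\<lambda>e. f ` e) ` edges H = edges H')"

definition contains_copy :: "graph \<Rightarrow> graph \<Rightarrow> bool" where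
  "contains_copy G H \<longleftrightarrow> (\<exists>f. inj_on f (verts H) \<and> f ` verts H \<subseteq> verts G \<and>
      (\<forall>e\<in>edges H. f ` e \<in> edges G))"

definition induced :: "graph \<Rightarrow> nat set \<Rightarrow> graph" where
  "induced G S = (verts G \<inter> S, {e \<in> edges G. e \<subseteq> S})"

definition proper_coloring :: "graph \<Rightarrow> (nat \<Rightarrow> nat) \<Rightarrow> nat \<Rightarrow> bool" where
  "proper_coloring G c k \<longleftrightarrow> c ` verts G \<subseteq> {..<k} \<and>
      (\<forall>e\<in>edges G. \<forall>u\<in>e. \<forall>v\<in>e. u \<noteq> v \<longrightarrow> c u \<noteq> c v)"

definition two_F_coloring :: "graph set \<Rightarrow> graph \<Rightarrow> (nat \<Rightarrow> nat) \<Rightarrow> nat \<Rightarrow> bool" where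
  "two_F_coloring \<F> G c k \<longleftrightarrow> proper_coloring G c k \<and>
      (\<forall>i j. i \<noteq> j \<longrightarrow> (\<forall>H\<in>\<F>. \<not> contains_copy (induced G {v \<in> verts G. c v = i \<or> c v = j}) H))"

definition chi2F :: "graph set \<Rightarrow> graph \<Rightarrow> nat" where
  "chi2F \<F> G = (LEAST k. \<exists>c. two_F_coloring \<F> G c k)"

text \<open>Maximum over all finite graphs of maximum degree at most \<Delta> (as an extended natural,
  so that unboundedness would be \<infinity>).\<close>
definition chi2F_Delta :: "graph set \<Rightarrow> nat \<Rightarrow> enat" where
  "chi2F_Delta \<F> \<Delta> = (SUP G\<in>{G. wf_graph G \<and> max_degree_le G \<Delta>}. enat (chi2F \<F> G))"

definition count_iso :: "graph set \<Rightarrow> (graph \<Rightarrow> bool) \<Rightarrow> nat" where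
  "count_iso \<F> P = card {C. \<exists>H\<in>\<F>. P H \<and> C = {H'\<in>\<F>. graph_iso H H'}}"

end

(* The colouring is found by Rosenfeld's counting method. Put D = Delta^(1/(m-1)), so that
   Delta^(m/(m-1)) = D^m. A colouring is admissible if it violates no constraint (A, B), that is,
   makes no A and B both monochromatic, and the number of admissible partial colourings grows by a
   factor beta at each new vertex as soon as the number of colours is at least beta plus the total
   weight, in powers of 1/beta, of the constraints through a vertex.

   The constraints are: the edges ({x, y}, {}); the special sets (J, {}), where J has so many common
   neighbours that |J| - 1 factors D make up for Delta; the two sides of each copy of a graph of the
   family on at most M vertices, taken up to isomorphism, whose sides contain no special set; and the
   sides of every connected bipartite set of M + 1 vertices, which occurs in every copy of a larger
   graph. Embedding a graph with h vertices and e edges vertex by vertex, with no special set in a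
   side, leaves at most (D^m)^(h-1) / D^e choices for a fixed root. So each graph costs at most h D^m,
   and only O(D^m / D) if it has more than m edges. Stars need no constraint of their own, since their
   leaves form a special set.

   The first bound is the choice M = m, beta = m D^m (trees with m edges have m + 1 vertices, so they
   fall under the large sets), the second one M = m + 1, beta = D^m. *)

theory Submission
  imports Defs
begin

subsection \<open>The counting argument\<close>

text \<open>If \<open>c\<close> is violated and contains \<open>v\<close>, the colours on \<open>t c\<close> vertices of \<open>W c\<close> and the colour of
  \<open>v\<close> are determined by the other ones. By induction on \<open>S\<close>, every vertex added to \<open>S\<close> multiplies the
  number of good colourings of \<open>S\<close> by at least \<open>\<beta>\<close>: those destroyed by \<open>c\<close> inject into the good
  colourings of a set with \<open>t c\<close> vertices less.\<close>

lemma rosenfeld_counting: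
  fixes V :: "'v set" and I :: "'i set" and W :: "'i \<Rightarrow> 'v set"
    and Bad :: "'i \<Rightarrow> ('v \<Rightarrow> nat) \<Rightarrow> bool" and t :: "'i \<Rightarrow> nat" and \<beta> :: real and k :: nat
  assumes finV: "finite V" and finI: "finite I" and \<beta>: "\<beta> > 0"
    and ne: "\<And>c. c \<in> I \<Longrightarrow> W c \<noteq> {}"
    and loc: "\<And>c \<phi> \<psi>. c \<in> I \<Longrightarrow> Bad c \<phi> \<Longrightarrow> (\<And>x. x \<in> W c \<Longrightarrow> \<phi> x = \<psi> x) \<Longrightarrow> Bad c \<psi>"
    and det: "\<And>c v. c \<in> I \<Longrightarrow> v \<in> W c \<Longrightarrow> \<exists>T\<subseteq>W c - {v}. card T = t c \<and>
        (\<forall>\<phi> \<psi>. Bad c \<phi> \<longrightarrow> Bad c \<psi> \<longrightarrow> (\<forall>x\<in>W c - {v} - T. \<phi> x = \<psi> x) \<longrightarrow> (\<forall>x\<in>W c. \<phi> x = \<psi> x))"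
    and sum: "\<And>v. v \<in> V \<Longrightarrow> \<beta> + (\<Sum>c\<in>{c\<in>I. v \<in> W c}. 1 / \<beta> ^ t c) \<le> real k"
  shows "\<exists>\<phi>. \<phi> ` V \<subseteq> {..<k} \<and> (\<forall>c\<in>I. W c \<subseteq> V \<longrightarrow> \<not> Bad c \<phi>)"
proof -
  \<comment> \<open>Colourings are \<open>undefined\<close> outside \<open>S\<close>, so that each
    is counted once, and only constraints lying within \<open>S\<close> are tested.\<close>
  define good where "good S = {\<phi> \<in> S \<rightarrow>\<^sub>E {..<k}. \<forall>c\<in>I. W c \<subseteq> S \<longrightarrow> \<not> Bad c \<phi>}" for S
  define N where "N S = real (card (good S))" for S
  have fin: "finite (good S)" if "S \<subseteq> V" for S
    using finite_PiE[of S "\<lambda>_. {..<k}"] finite_subset[OF that finV] unfolding good_def by simp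
  have step: "\<beta> * N S \<le> N (insert v S)" if "S \<subseteq> V" "v \<in> V - S" for S v
    using that
  proof (induction "card S" arbitrary: S v rule: less_induct)
    case less
    have finS: "finite S" using less.prems finV finite_subset by blast
    \<comment> \<open>The induction hypothesis, applied to one vertex of \<open>T\<close> after the
      other: forgetting \<open>T\<close> divides the count by at least
      \<open>\<beta> ^ card T\<close>.\<close>
    have mono: "\<beta> ^ card T * N (S - T) \<le> N S" if "T \<subseteq> S" for T
    proof -
      have "finite T" using that finS finite_subset by blast
      then show ?thesis using that
      proof (induction T rule: finite_induct)
        case (insert x T)
        have "card (S - insert x T) < card S"
          using insert.prems finS by (intro psubset_card_mono) auto
        then have "\<beta> * N (S - insert x T) \<le> N (insert x (S - insert x T))"
          using less.hyps[of "S - insert x T" x] less.prems insert by auto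
        also have "insert x (S - insert x T) = S - T" using insert by auto
        finally have "\<beta> ^ card T * (\<beta> * N (S - insert x T)) \<le> \<beta> ^ card T * N (S - T)"
          using \<beta> by (intro mult_left_mono) auto
        also have "\<dots> \<le> N S" using insert by auto
        finally show ?case using insert by (simp add: mult_ac)
      qed simp
    qed
    define Ext where "Ext = {\<phi> \<in> insert v S \<rightarrow>\<^sub>E {..<k}. restrict \<phi> S \<in> good S}"
    define Iv where "Iv = {c\<in>I. v \<in> W c}"
    define B where "B c = {\<phi>\<in>Ext. Bad c \<phi> \<and> W c \<subseteq> insert v S}" for c
    have finExt: "finite Ext"
      using finite_PiE[of "insert v S" "\<lambda>_. {..<k}"] finS unfolding Ext_def by simp
    have inj: "inj_on (\<lambda>(\<phi>, i). \<phi>(v := i)) (good S \<times> {..<k})"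
    proof (rule inj_onI, clarsimp)
      fix \<phi> \<psi> i j assume a: "\<phi> \<in> good S" "\<psi> \<in> good S" "\<phi>(v := i) = \<psi>(v := j)"
      have "\<phi> v = undefined" "\<psi> v = undefined"
        using a less.prems unfolding good_def by (auto simp: PiE_def extensional_def)
      then show "\<phi> = \<psi> \<and> i = j" using a(3)
        by (metis fun_upd_same fun_upd_triv fun_upd_upd)
    qed
    have "(\<lambda>(\<phi>, i). \<phi>(v := i)) ` (good S \<times> {..<k}) \<subseteq> Ext"
    proof clarsimp
      fix \<phi> i assume a: "\<phi> \<in> good S" "i < k"
      have "restrict (\<phi>(v := i)) S = \<phi>"
        using a less.prems unfolding good_def
        by (auto simp: PiE_def extensional_def restrict_def fun_eq_iff)
      then show "\<phi>(v := i) \<in> Ext" using a unfolding Ext_def good_def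
        by (auto simp: PiE_def extensional_def Pi_def)
    qed
    from card_inj_on_le[OF inj this finExt] have "card (good S) * k \<le> card Ext"
      by (simp add: card_cartesian_product)
    then have E: "N S * real k \<le> real (card Ext)"
      unfolding N_def by (metis of_nat_le_iff of_nat_mult)
    \<comment> \<open>A constraint that avoids \<open>v\<close> and is violated by an extension is
      already violated by the restriction to \<open>S\<close>, which is good; so only constraints
      through \<open>v\<close> can destroy an extension.\<close>
    have sub: "Ext \<subseteq> good (insert v S) \<union> (\<Union>c\<in>Iv. B c)"
    proof
      fix \<phi> assume p: "\<phi> \<in> Ext"
      show "\<phi> \<in> good (insert v S) \<union> (\<Union>c\<in>Iv. B c)"
      proof (rule ccontr)
        assume n: "\<not> ?thesis"
        then obtain c where c: "c \<in> I" "W c \<subseteq> insert v S" "Bad c \<phi>"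
          using p unfolding Ext_def good_def by auto
        show False
        proof (cases "v \<in> W c")
          case True then show False using c n p unfolding B_def Iv_def by auto
        next
          case False
          then have "W c \<subseteq> S" using c by auto
          moreover from this have "Bad c (restrict \<phi> S)" using loc[OF c(1,3)] by (auto simp: subset_iff)
          ultimately show False using p c(1) unfolding Ext_def good_def by auto
        qed
      qed
    qed
    have Bc: "real (card (B c)) \<le> N S * (1 / \<beta> ^ t c)" if c: "c \<in> Iv" for c
    proof (cases "W c \<subseteq> insert v S")
      case False
      then have "B c = {}" unfolding B_def by auto
      then show ?thesis using \<beta> by (simp add: N_def)
    next
      case True
      obtain T where T: "T \<subseteq> W c - {v}" "card T = t c"
        "\<And>\<phi> \<psi>. Bad c \<phi> \<Longrightarrow> Bad c \<psi> \<Longrightarrow> (\<forall>x\<in>W c - {v} - T. \<phi> x = \<psi> x) \<Longrightarrow> (\<forall>x\<in>W c. \<phi> x = \<psi> x)"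
        using det[of c v] c unfolding Iv_def by blast
      have TS: "T \<subseteq> S" using T True by auto
      \<comment> \<open>Both \<open>v\<close> and \<open>T\<close> are forgotten: what is left of
        \<open>W c\<close> still fixes a violating colouring on all of \<open>W c\<close>.\<close>
      have "inj_on (\<lambda>\<phi>. restrict \<phi> (S - T)) (B c)"
      proof (rule inj_onI)
        fix \<phi> \<psi> assume a: "\<phi> \<in> B c" "\<psi> \<in> B c" "restrict \<phi> (S - T) = restrict \<psi> (S - T)"
        have ag: "\<phi> x = \<psi> x" if "x \<in> S - T" for x using a(3) that by (metis restrict_apply')
        have "\<forall>x\<in>W c. \<phi> x = \<psi> x" using T(3)[of \<phi> \<psi>] a ag True unfolding B_def by blast
        then have "\<forall>x\<in>insert v S. \<phi> x = \<psi> x" using ag c T unfolding Iv_def by blast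
        then show "\<phi> = \<psi>" using a unfolding B_def Ext_def
          by (auto intro: PiE_ext[of _ "insert v S" "\<lambda>_. {..<k}"])
      qed
      moreover have "(\<lambda>\<phi>. restrict \<phi> (S - T)) ` B c \<subseteq> good (S - T)"
      proof clarify
        fix \<phi> assume p: "\<phi> \<in> B c"
        have "\<not> Bad c' (restrict \<phi> (S - T))" if "c' \<in> I" "W c' \<subseteq> S - T" for c'
        proof
          assume "Bad c' (restrict \<phi> (S - T))"
          then have "Bad c' (restrict \<phi> S)" using loc[OF that(1)] that(2)
            by (metis (no_types, lifting) DiffD1 restrict_apply' subsetD)
          then show False using p that unfolding B_def Ext_def good_def by auto
        qed
        then show "restrict \<phi> (S - T) \<in> good (S - T)"
          using p unfolding B_def Ext_def good_def by (auto simp: PiE_def Pi_def)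
      qed
      ultimately have "card (B c) \<le> card (good (S - T))"
        using card_inj_on_le fin[of "S - T"] less.prems by blast
      then have "real (card (B c)) \<le> N (S - T)" unfolding N_def by simp
      also have "\<dots> \<le> N S * (1 / \<beta> ^ t c)" using mono[OF TS] T(2) \<beta> by (simp add: field_simps)
      finally show ?thesis .
    qed
    have finIv: "finite Iv" using finI unfolding Iv_def by simp
    have finB: "finite (B c)" for c using finExt unfolding B_def by simp
    have fing: "finite (good (insert v S))" using fin[of "insert v S"] less.prems by auto
    have "card Ext \<le> card (good (insert v S) \<union> (\<Union>c\<in>Iv. B c))"
      using sub finIv finB fing by (intro card_mono) auto
    also have "\<dots> \<le> card (good (insert v S)) + card (\<Union>c\<in>Iv. B c)" by (rule card_Un_le)
    also have "\<dots> \<le> card (good (insert v S)) + (\<Sum>c\<in>Iv. card (B c))"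
      using card_UN_le[OF finIv] by simp
    finally have "real (card Ext) \<le> real (card (good (insert v S)) + (\<Sum>c\<in>Iv. card (B c)))"
      by (rule of_nat_mono)
    then have "real (card Ext) \<le> N (insert v S) + (\<Sum>c\<in>Iv. real (card (B c)))"
      unfolding N_def by simp
    also have "\<dots> \<le> N (insert v S) + (\<Sum>c\<in>Iv. N S * (1 / \<beta> ^ t c))"
      using Bc by (intro add_left_mono sum_mono) auto
    also have "\<dots> = N (insert v S) + N S * (\<Sum>c\<in>Iv. 1 / \<beta> ^ t c)" by (simp only: sum_distrib_left)
    finally have 1: "N S * (real k - (\<Sum>c\<in>Iv. 1 / \<beta> ^ t c)) \<le> N (insert v S)"
      using E by (simp add: algebra_simps)
    have "N S * \<beta> \<le> N S * (real k - (\<Sum>c\<in>Iv. 1 / \<beta> ^ t c))"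
      using sum[of v] less.prems unfolding Iv_def by (intro mult_left_mono) (auto simp: N_def)
    then show ?case using 1 by (simp add: mult.commute)
  qed
  have "N S > 0" if "S \<subseteq> V" for S
  proof -
    have "finite S" using that finV finite_subset by blast
    then show ?thesis using that
    proof (induction S rule: finite_induct)
      case empty
      \<comment> \<open>The empty colouring is good, because by \<open>ne\<close> no constraint fits
        into the empty set.\<close>
      have "good {} = {\<lambda>_. undefined}" unfolding good_def using ne by auto
      then show ?case unfolding N_def by simp
    next
      case (insert v S)
      then have "0 < \<beta> * N S" using \<beta> by simp
      also have "\<dots> \<le> N (insert v S)" using step insert by auto
      finally show ?case .
    qed
  qed
  then have "N V > 0" by simp
  then obtain \<phi> where "\<phi> \<in> good V" unfolding N_def by (metis card.empty equals0I of_nat_0 less_irrefl)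
  then show ?thesis unfolding good_def by (intro exI[of _ \<phi>]) (auto simp: PiE_def Pi_def)
qed

subsection \<open>Connectedness by cuts\<close>

text \<open>Connectedness by cuts rather than paths: an edge across a cut directly hands over the
  next vertex when a set is grown one vertex at a time.\<close>

definition cut_connected :: "'a set set \<Rightarrow> 'a set \<Rightarrow> bool" where
  "cut_connected E Y \<longleftrightarrow>
    (\<forall>X. X \<subseteq> Y \<longrightarrow> X \<noteq> {} \<longrightarrow> X \<noteq> Y \<longrightarrow> (\<exists>x\<in>X. \<exists>y\<in>Y - X. {x, y} \<in> E))"

lemma cut_connectedE:
  assumes "cut_connected E Y" "X \<subseteq> Y" "X \<noteq> {}" "X \<noteq> Y"
  obtains x y where "x \<in> X" "y \<in> Y - X" "{x, y} \<in> E"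
  using assms unfolding cut_connected_def by blast

text \<open>If no edge left \<open>X\<close>, then \<open>X\<close> would contain every vertex
  reachable from one of its own.\<close>

lemma cut_connected_graph:
  assumes "wf_graph H" "connected_graph H"
  shows "cut_connected (edges H) (verts H)"
  unfolding cut_connected_def
proof (intro allI impI)
  fix X assume X: "X \<subseteq> verts H" "X \<noteq> {}" "X \<noteq> verts H"
  then obtain a b where ab: "a \<in> X" "b \<in> verts H - X" by blast
  show "\<exists>x\<in>X. \<exists>y\<in>verts H - X. {x, y} \<in> edges H"
  proof (rule ccontr)
    assume no: "\<not> ?thesis"
    have "(adj H)\<^sup>*\<^sup>* a b" using assms(2) ab X unfolding connected_graph_def by blast
    then have "b \<in> X"
    proof (induction rule: rtranclp_induct)
      case (step y z)
      then have "{y, z} \<in> edges H" unfolding adj_def by simp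
      moreover from this have "z \<in> verts H" using assms(1) unfolding wf_graph_def by blast
      ultimately show ?case using no step by blast
    qed (use ab in simp)
    then show False using ab by simp
  qed
qed

text \<open>A cut of the image pulls back to a cut of \<open>Y\<close>, and an edge across the
  latter is mapped to one across the former.\<close>

lemma cut_connected_image:
  assumes "cut_connected E Y" "\<And>x y. x \<in> Y \<Longrightarrow> y \<in> Y \<Longrightarrow> {x, y} \<in> E \<Longrightarrow> {f x, f y} \<in> E'"
  shows "cut_connected E' (f ` Y)"
  unfolding cut_connected_def
proof (intro allI impI)
  fix X assume X: "X \<subseteq> f ` Y" "X \<noteq> {}" "X \<noteq> f ` Y"
  obtain x y where "x \<in> {x\<in>Y. f x \<in> X}" "y \<in> Y - {x\<in>Y. f x \<in> X}" "{x, y} \<in> E"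
    by (rule cut_connectedE[OF assms(1), of "{x\<in>Y. f x \<in> X}"]) (use X in auto)
  then show "\<exists>x\<in>X. \<exists>y\<in>f ` Y - X. {x, y} \<in> E'" using assms(2)[of x y] by blast
qed

lemma cut_connected_mono:
  assumes "cut_connected E Y" "\<And>x y. x \<in> Y \<Longrightarrow> y \<in> Y \<Longrightarrow> {x, y} \<in> E \<Longrightarrow> {x, y} \<in> E'"
  shows "cut_connected E' Y"
  using cut_connected_image[of E Y "\<lambda>x. x" E'] assms by simp

lemma cut_connected_insert:
  assumes "cut_connected E S" "x \<in> S" "{x, y} \<in> E"
  shows "cut_connected E (insert y S)"
  unfolding cut_connected_def
proof (intro allI impI)
  fix X assume X: "X \<subseteq> insert y S" "X \<noteq> {}" "X \<noteq> insert y S"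
  have yx: "{y, x} \<in> E" using assms(3) by (simp add: insert_commute)
  consider "X \<inter> S = {}" | "S \<subseteq> X" | "X \<inter> S \<noteq> {}" "X \<inter> S \<noteq> S" by blast
  then show "\<exists>x\<in>X. \<exists>y\<in>insert y S - X. {x, y} \<in> E"
  proof cases
    case 1 then show ?thesis using X yx assms(2) by blast
  next
    case 2 then show ?thesis using X assms(2,3) by blast
  next
    case 3
    then obtain u w where "u \<in> X \<inter> S" "w \<in> S - X \<inter> S" "{u, w} \<in> E"
      using cut_connectedE[OF assms(1), of "X \<inter> S"] by blast
    then show ?thesis by blast
  qed
qed

text \<open>The set is grown from one vertex along edges across the current cut. This serves to take
  \<open>M + 1\<close> connected vertices out of a large copy.\<close>

lemma cut_connected_subset:
  assumes "cut_connected E Y" "finite Y" "Suc n \<le> card Y"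
  obtains S where "S \<subseteq> Y" "card S = Suc n" "cut_connected E S"
proof -
  have "\<exists>S\<subseteq>Y. card S = Suc n \<and> cut_connected E S" using assms(3)
  proof (induction n)
    case 0
    then obtain a where "a \<in> Y" by (metis Suc_n_not_le_n all_not_in_conv card.empty)
    then show ?case unfolding cut_connected_def by (intro exI[of _ "{a}"]) auto
  next
    case (Suc n)
    then obtain S where S: "S \<subseteq> Y" "card S = Suc n" "cut_connected E S" by auto
    obtain x y where xy: "x \<in> S" "y \<in> Y - S" "{x, y} \<in> E"
      by (rule cut_connectedE[OF assms(1) S(1)]) (use S Suc.prems in auto)
    moreover have "finite S" using S assms(2) finite_subset by blast
    ultimately show ?case using cut_connected_insert[OF S(3) xy(1,3)] S
      by (intro exI[of _ "insert y S"]) auto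
  qed
  then show ?thesis using that by blast
qed

text \<open>The cut between the vertices with \<open>P\<close> and those without would be crossed by
  an edge, along which \<open>P\<close> cannot get lost.\<close>

lemma cut_connected_induct:
  assumes "cut_connected E Y" "a \<in> Y" "P a"
    "\<And>x y. x \<in> Y \<Longrightarrow> y \<in> Y \<Longrightarrow> {x, y} \<in> E \<Longrightarrow> P x \<Longrightarrow> P y" "b \<in> Y"
  shows "P b"
proof (rule ccontr)
  assume "\<not> P b"
  obtain x y where "x \<in> {x\<in>Y. P x}" "y \<in> Y - {x\<in>Y. P x}" "{x, y} \<in> E"
    by (rule cut_connectedE[OF assms(1), of "{x\<in>Y. P x}"]) (use assms \<open>\<not> P b\<close> in auto)
  then show False using assms(4)[of x y] by auto
qed

text \<open>Expansion of a product of factors \<open>x + 1\<close> over \<open>S\<close>, where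
  \<open>X\<close> collects the elements that contribute \<open>x\<close>.\<close>

lemma sum_power_card_Pow:
  fixes x :: real
  assumes "finite S"
  shows "(\<Sum>X\<in>Pow S. x ^ card X) = (1 + x) ^ card S"
proof -
  have "(\<Prod>a\<in>S. x + 1) = (\<Sum>X\<in>Pow S. (\<Prod>a\<in>X. x) * (\<Prod>a\<in>S - X. 1))"
    using prod_add[OF assms, of "\<lambda>_. x" "\<lambda>_. 1"] by simp
  then show ?thesis by (simp add: add.commute)
qed

subsection \<open>Constraints in a graph of bounded degree\<close>

text \<open>\<open>D\<close> is given by \<open>D_power\<close> instead of as a real root, which
  keeps the estimates to natural powers. With \<open>D1\<close> this forces
  \<open>\<Delta> \<ge> 1\<close>.\<close>

locale bounded_graph =
  fixes V :: "nat set" and E :: "nat set set" and \<Delta> :: nat and D :: real and m :: nat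
  assumes finV: "finite V" and E_V: "e \<in> E \<Longrightarrow> e \<subseteq> V" and E_2: "e \<in> E \<Longrightarrow> card e = 2"
    and deg: "v \<in> V \<Longrightarrow> card {u. {v, u} \<in> E} \<le> \<Delta>"
    and D1: "D \<ge> 1" and D_power: "D ^ (m - 1) = real \<Delta>" and m2: "m \<ge> 2"
begin

definition nbr :: "nat \<Rightarrow> nat set" where "nbr v = {u. {v, u} \<in> E}"

definition common_nbr :: "nat set \<Rightarrow> nat set" where
  "common_nbr J = {w. \<forall>x\<in>J. {x, w} \<in> E}"

text \<open>The threshold is chosen so that the special sets through a vertex have total weight
  \<open>O(D ^ m)\<close>, while a common neighbour of a non-special set of size \<open>j\<close> can be chosen in less than
  \<open>\<Delta> / D ^ (j - 1) = D ^ m / D ^ j\<close> ways, so that in an embedding every edge saves a factor \<open>D\<close>.\<close>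

definition special :: "nat set \<Rightarrow> bool" where
  "special J \<longleftrightarrow> J \<subseteq> V \<and> 2 \<le> card J \<and> real \<Delta> \<le> real (card (common_nbr J)) * D ^ (card J - 1)"

lemma Dm: "D ^ m = real \<Delta> * D"
  using D_power m2 power_Suc2[of D "m - 1"] by simp

lemma D_pos: "D > 0" using D1 by simp

lemma Dm1: "D ^ m \<ge> 1" using D1 by simp

lemma \<Delta>1: "real \<Delta> \<ge> 1" using D_power D1 by (metis one_le_power)

lemma nbr_V: "nbr v \<subseteq> V" using E_V unfolding nbr_def by blast

lemma fin_nbr: "finite (nbr v)" using nbr_V finV finite_subset by blast

lemma card_nbr: "card (nbr v) \<le> \<Delta>"
proof (cases "v \<in> V")
  case True then show ?thesis using deg unfolding nbr_def by simp
next
  case False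
  then have "nbr v = {}" using E_V unfolding nbr_def by blast
  then show ?thesis by simp
qed

lemma common_nbr_sub: "v \<in> J \<Longrightarrow> common_nbr J \<subseteq> nbr v" unfolding common_nbr_def nbr_def by blast

lemma fin_special: "finite {J. special J}"
  by (rule finite_subset[of _ "Pow V"]) (auto simp: special_def finV)

text \<open>Double counting of pairs of a special set \<open>J\<close> and a common neighbour
  \<open>w\<close>. By the definition of \<open>special\<close>, the weight of \<open>J\<close> is
  at most \<open>g J\<close> times the number of its common neighbours. Each \<open>w\<close> is one
  of at most \<open>\<Delta>\<close> neighbours of \<open>v\<close>, and the sets \<open>J\<close>
  within \<open>nbr w\<close> cost at most \<open>2 * D\<close> together.\<close>

lemma special_sum:
  assumes "\<beta> \<ge> D ^ m"
  shows "(\<Sum>J\<in>{J. special J \<and> v \<in> J}. 1 / \<beta> ^ (card J - 2)) \<le> 2 * D ^ m"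
proof -
  define P where "P = {J. special J \<and> v \<in> J}"
  have finP: "finite P" using fin_special unfolding P_def by simp
  \<comment> \<open>The cost per common neighbour,
    \<open>D ^ (card J - 1) / \<Delta> / (D ^ m) ^ (card J - 2)\<close>, simplified by
    \<open>Dm\<close>.\<close>
  define g where "g J = D * (1 / real \<Delta>) ^ (card J - 1)" for J :: "nat set"
  have g0: "g J \<ge> 0" for J using D_pos \<Delta>1 unfolding g_def by simp
  have 1: "1 / \<beta> ^ (card J - 2) \<le> (\<Sum>w\<in>nbr v. if J \<subseteq> nbr w then g J else 0)" if J: "J \<in> P" for J
  proof -
    obtain i where i: "card J = i + 2" using J that[of "card J - 2"] unfolding P_def special_def by auto
    have "1 / \<beta> ^ (card J - 2) \<le> 1 / (D ^ m) ^ i"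
      using assms Dm1 i by (auto intro!: divide_left_mono power_mono mult_pos_pos)
    also have "\<dots> \<le> (real (card (common_nbr J)) * D ^ (i + 1) / real \<Delta>) / (D ^ m) ^ i"
      using J i \<Delta>1 Dm1 unfolding P_def special_def by (intro divide_right_mono) auto
    also have "\<dots> = real (card (common_nbr J)) * g J"
      using \<Delta>1 D_pos unfolding g_def Dm i by (simp add: field_simps)
    also have "common_nbr J = {w\<in>nbr v. J \<subseteq> nbr w}"
      using J unfolding P_def common_nbr_def nbr_def by (auto simp: insert_commute)
    also have "real (card {w\<in>nbr v. J \<subseteq> nbr w}) * g J = (\<Sum>w\<in>nbr v. if J \<subseteq> nbr w then g J else 0)"
      by (simp add: sum.If_cases fin_nbr Int_def)
    finally show ?thesis .
  qed
  have 2: "(\<Sum>J\<in>P. if J \<subseteq> nbr w then g J else 0) \<le> 2 * D" if w: "w \<in> nbr v" for w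
  proof -
    define S where "S = nbr w - {v}"
    have finS: "finite S" using fin_nbr unfolding S_def by simp
    have cS: "card S \<le> \<Delta>" using card_nbr[of w] card_Diff1_le[of "nbr w" v] unfolding S_def by linarith
    have inj: "inj_on (\<lambda>J. J - {v}) {J\<in>P. J \<subseteq> nbr w}"
      unfolding P_def by (rule inj_onI) blast
    have img: "(\<lambda>J. J - {v}) ` {J\<in>P. J \<subseteq> nbr w} \<subseteq> Pow S - {{}}"
    proof clarify
      fix J assume J: "J \<in> P" "J \<subseteq> nbr w"
      have "J - {v} \<noteq> {}"
      proof
        assume "J - {v} = {}"
        then have "card J \<le> 1" using card_mono[of "{v}" J] by auto
        then show False using J unfolding P_def special_def by simp
      qed
      then show "J - {v} \<in> Pow S - {{}}" using J unfolding S_def by auto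
    qed
    have gJ: "g J = D * (1 / real \<Delta>) ^ card (J - {v})" if "J \<in> P" for J
      using that unfolding g_def P_def by (simp add: card_Diff_singleton)
    have "(\<Sum>J\<in>P. if J \<subseteq> nbr w then g J else 0) = (\<Sum>J\<in>{J\<in>P. J \<subseteq> nbr w}. g J)"
      using finP by (simp add: sum.inter_filter)
    also have "\<dots> = (\<Sum>J\<in>{J\<in>P. J \<subseteq> nbr w}. D * (1 / real \<Delta>) ^ card (J - {v}))"
      using gJ by (intro sum.cong) auto
    also have "\<dots> = (\<Sum>X\<in>(\<lambda>J. J - {v}) ` {J\<in>P. J \<subseteq> nbr w}. D * (1 / real \<Delta>) ^ card X)"
      by (simp add: sum.reindex[OF inj])
    also have "\<dots> \<le> (\<Sum>X\<in>Pow S - {{}}. D * (1 / real \<Delta>) ^ card X)"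
      using img finS D_pos by (intro sum_mono2) auto
    \<comment> \<open>A special set has an element besides \<open>v\<close>, so the empty set does
      not occur; this \<open>- 1\<close> lowers the bound from \<open>3 * D\<close> to
      \<open>2 * D\<close>.\<close>
    also have "\<dots> = D * ((\<Sum>X\<in>Pow S. (1 / real \<Delta>) ^ card X) - 1)"
      using finS by (simp add: sum_diff1 flip: sum_distrib_left)
    also have "\<dots> = D * ((1 + 1 / real \<Delta>) ^ card S - 1)"
      by (simp only: sum_power_card_Pow[OF finS])
    also have "\<dots> \<le> D * (3 - 1)"
    proof -
      have "(1 + 1 / real \<Delta>) ^ card S \<le> (1 + 1 / real \<Delta>) ^ \<Delta>"
        using cS by (intro power_increasing) auto
      also have "\<dots> \<le> exp (1 / real \<Delta>) ^ \<Delta>"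
        by (intro power_mono exp_ge_add_one_self) auto
      also have "\<dots> = exp 1" using \<Delta>1 by (simp flip: exp_of_nat_mult)
      also have "\<dots> \<le> 3" by (rule exp_le)
      finally show ?thesis using D_pos by (intro mult_left_mono) auto
    qed
    finally show ?thesis by simp
  qed
  have "(\<Sum>J\<in>P. 1 / \<beta> ^ (card J - 2)) \<le> (\<Sum>J\<in>P. \<Sum>w\<in>nbr v. if J \<subseteq> nbr w then g J else 0)"
    by (intro sum_mono 1)
  also have "\<dots> = (\<Sum>w\<in>nbr v. \<Sum>J\<in>P. if J \<subseteq> nbr w then g J else 0)" by (rule sum.swap)
  also have "\<dots> \<le> (\<Sum>w\<in>nbr v. 2 * D)" by (intro sum_mono 2)
  also have "\<dots> = real (card (nbr v)) * (2 * D)" by simp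
  also have "\<dots> \<le> real \<Delta> * (2 * D)" using card_nbr D_pos by (intro mult_right_mono) auto
  finally show ?thesis unfolding P_def Dm by simp
qed

text \<open>The two sides of the trees that arise from \<open>v\<close> by attaching \<open>n\<close> edges one after the other.
  The root can be on either side.\<close>

primrec grow :: "nat \<Rightarrow> nat \<Rightarrow> (nat set \<times> nat set) set" where
  "grow v 0 = {({v}, {}), ({}, {v})}"
| "grow v (Suc n) = (\<Union>p\<in>grow v n. \<Union>x\<in>fst p \<union> snd p. (\<lambda>y.
      if x \<in> fst p then (fst p, insert y (snd p)) else (insert y (fst p), snd p)) ` nbr x)"

lemma grow_fin: "finite (grow v n) \<and> (\<forall>p\<in>grow v n. finite (fst p \<union> snd p) \<and> card (fst p \<union> snd p) \<le> n + 1)"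
proof (induction n)
  case (Suc n)
  have "finite (fst q \<union> snd q) \<and> card (fst q \<union> snd q) \<le> n + 2" if q: "q \<in> grow v (Suc n)" for q
  proof -
    obtain p x y where p: "p \<in> grow v n"
      "q = (if x \<in> fst p then (fst p, insert y (snd p)) else (insert y (fst p), snd p))"
      using q[unfolded grow.simps] by blast
    then have py: "p \<in> grow v n" "fst q \<union> snd q = insert y (fst p \<union> snd p)" by auto
    then have "finite (fst p \<union> snd p)" "card (fst p \<union> snd p) \<le> n + 1" using Suc by auto
    then show ?thesis unfolding py(2) by (auto simp: card_insert_if)
  qed
  moreover have "finite (grow v (Suc n))" using Suc fin_nbr by auto
  ultimately show ?case by auto
qed auto

text \<open>The next edge starts at one of at most \<open>n + 1\<close> vertices and has at most
  \<open>\<Delta>\<close> possible other ends; the factor 2 is the choice of the side of the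
  root.\<close>

lemma card_grow: "card (grow v n) \<le> 2 * fact n * \<Delta> ^ n"
proof (induction n)
  case 0 then show ?case using card_insert_le_m1[of 2 "{({}, {v})}"] by simp
next
  case (Suc n)
  have 1: "card (\<Union>x\<in>fst p \<union> snd p. (\<lambda>y.
      if x \<in> fst p then (fst p, insert y (snd p)) else (insert y (fst p), snd p)) ` nbr x) \<le> (n + 1) * \<Delta>"
    (is "card (\<Union>x\<in>_. ?f x) \<le> _") if "p \<in> grow v n" for p
  proof -
    have f: "finite (fst p \<union> snd p)" "card (fst p \<union> snd p) \<le> n + 1" using grow_fin that by auto
    have "card (\<Union>x\<in>fst p \<union> snd p. ?f x) \<le> (\<Sum>x\<in>fst p \<union> snd p. card (?f x))"
      by (rule card_UN_le[OF f(1)])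
    also have "\<dots> \<le> (\<Sum>x\<in>fst p \<union> snd p. \<Delta>)"
      by (intro sum_mono order.trans[OF card_image_le card_nbr] fin_nbr)
    also have "\<dots> \<le> (n + 1) * \<Delta>" using f(2) by (simp only: sum_constant of_nat_id mult_right_mono)
    finally show ?thesis .
  qed
  have "card (grow v (Suc n)) \<le> (\<Sum>p\<in>grow v n. (n + 1) * \<Delta>)"
    unfolding grow.simps using grow_fin
    by (intro order.trans[OF card_UN_le] sum_mono 1) auto
  also have "\<dots> = card (grow v n) * ((n + 1) * \<Delta>)" by simp
  also have "\<dots> \<le> 2 * fact n * \<Delta> ^ n * ((n + 1) * \<Delta>)" using Suc by (intro mult_right_mono) auto
  also have "\<dots> = 2 * fact (Suc n) * \<Delta> ^ Suc n" by (simp add: algebra_simps)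
  finally show ?case .
qed

text \<open>Only edges between the sides connect, so that a vertex reached along such an edge lies
  on the side opposite to its predecessor, as in \<open>grow\<close>.\<close>

definition bip_connected :: "nat set \<Rightarrow> nat set \<Rightarrow> bool" where
  "bip_connected A B \<longleftrightarrow> A \<inter> B = {} \<and> A \<union> B \<subseteq> V \<and>
     cut_connected {{x, y} | x y. x \<in> A \<and> y \<in> B \<and> {x, y} \<in> E} (A \<union> B)"

text \<open>A spanning tree is built from \<open>v\<close>: an edge across the cut between the
  reached vertices and the rest gives one step of \<open>grow\<close>, and after \<open>n\<close>
  steps all \<open>n + 1\<close> vertices are reached.\<close>

lemma bip_connected_grow:
  assumes bip: "bip_connected A B" and v: "v \<in> A \<union> B" and c: "card (A \<union> B) = n + 1"
  shows "(A, B) \<in> grow v n"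
proof -
  have AB: "A \<inter> B = {}" "A \<union> B \<subseteq> V" using bip unfolding bip_connected_def by auto
  have fin: "finite (A \<union> B)" using AB finV finite_subset by blast
  have "\<exists>A' B'. A' \<subseteq> A \<and> B' \<subseteq> B \<and> (A', B') \<in> grow v i \<and> card (A' \<union> B') = i + 1" if "i \<le> n" for i
    using that
  proof (induction i)
    case 0
    show ?case
    proof (cases "v \<in> A")
      case True then show ?thesis by (intro exI[of _ "{v}"] exI[of _ "{}"]) auto
    next
      case False then show ?thesis using v by (intro exI[of _ "{v}"] exI[of _ "{}"]) auto
    qed
  next
    case (Suc i)
    then obtain A' B' where s: "A' \<subseteq> A" "B' \<subseteq> B" "(A', B') \<in> grow v i" "card (A' \<union> B') = i + 1" by auto
    have fin': "finite (A' \<union> B')" using s fin by (meson Un_mono finite_subset)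
    have cut: "cut_connected {{x, y} | x y. x \<in> A \<and> y \<in> B \<and> {x, y} \<in> E} (A \<union> B)"
      using bip unfolding bip_connected_def by simp
    have "A' \<union> B' \<subseteq> A \<union> B" "A' \<union> B' \<noteq> {}" "A' \<union> B' \<noteq> A \<union> B" using s c Suc.prems by auto
    then obtain x y where xy: "x \<in> A' \<union> B'" "y \<in> A \<union> B - (A' \<union> B')"
      "{x, y} \<in> {{x, y} | x y. x \<in> A \<and> y \<in> B \<and> {x, y} \<in> E}" by (rule cut_connectedE[OF cut])
    then have ynb: "y \<in> nbr x" unfolding nbr_def by (auto simp: insert_commute)
    show ?case
    proof (cases "x \<in> A'")
      case True
      then have "y \<in> B" using xy(3) s AB by (auto simp: doubleton_eq_iff)
      moreover have "(A', insert y B') \<in> grow v (Suc i)"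
        unfolding grow.simps by (intro UN_I[OF s(3)] UN_I[of x] image_eqI[of _ _ y]) (use True ynb in auto)
      moreover have "card (A' \<union> insert y B') = Suc i + 1" using s(4) xy(2) fin' by simp
      ultimately show ?thesis using s by (intro exI[of _ A'] exI[of _ "insert y B'"]) auto
    next
      case False
      then have "x \<in> B'" using xy by auto
      then have "y \<in> A" using xy(3) s AB by (auto simp: doubleton_eq_iff)
      moreover have "(insert y A', B') \<in> grow v (Suc i)"
        unfolding grow.simps by (intro UN_I[OF s(3)] UN_I[of x] image_eqI[of _ _ y])
          (use False \<open>x \<in> B'\<close> ynb in auto)
      moreover have "card (insert y A' \<union> B') = Suc i + 1" using s(4) xy(2) fin' by simp
      ultimately show ?thesis using s by (intro exI[of _ "insert y A'"] exI[of _ B']) auto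
    qed
  qed
  from this[of n] obtain A' B' where s: "A' \<subseteq> A" "B' \<subseteq> B" "(A', B') \<in> grow v n" "card (A' \<union> B') = n + 1"
    by auto
  then have "A' \<union> B' = A \<union> B" using card_subset_eq[OF fin, of "A' \<union> B'"] c by auto
  then have "A' = A" "B' = B" using s AB by auto
  then show ?thesis using s by simp
qed

text \<open>All these pairs have the same weight: \<open>card A + card B = n + 1\<close> with both
  sides of size at least 2 makes the exponent \<open>n - 2\<close>. It remains to count them by
  \<open>card_grow\<close>.\<close>

lemma bip_connected_sum:
  assumes "\<beta> > 0"
  shows "(\<Sum>(A, B)\<in>{(A, B). bip_connected A B \<and> 2 \<le> card A \<and> 2 \<le> card B \<and> card (A \<union> B) = n + 1 \<and> v \<in> A \<union> B}.
      1 / \<beta> ^ ((card A - 2) + (card B - 1))) \<le> 2 * fact n * real \<Delta> ^ n / \<beta> ^ (n - 2)"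
    (is "(\<Sum>(A, B)\<in>?K. _) \<le> _")
proof -
  have sub: "?K \<subseteq> grow v n" using bip_connected_grow by auto
  then have ck: "card ?K \<le> 2 * fact n * \<Delta> ^ n" using order.trans[OF card_mono card_grow] grow_fin by simp
  have ex: "(card A - 2) + (card B - 1) = n - 2" if "(A, B) \<in> ?K" for A B
  proof -
    have "A \<inter> B = {}" "finite A" "finite B"
      using that finV unfolding bip_connected_def by (auto intro: finite_subset)
    then have "card A + card B = n + 1" using that by (simp add: card_Un_disjoint)
    then show ?thesis using that by auto
  qed
  have "(\<Sum>(A, B)\<in>?K. 1 / \<beta> ^ ((card A - 2) + (card B - 1))) = (\<Sum>p\<in>?K. 1 / \<beta> ^ (n - 2))"
    by (intro sum.cong refl) (use ex in auto)
  also have "\<dots> = real (card ?K) / \<beta> ^ (n - 2)" by simp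
  also have "\<dots> \<le> real (2 * fact n * \<Delta> ^ n) / \<beta> ^ (n - 2)"
    using ck assms by (intro divide_right_mono of_nat_mono) auto
  finally show ?thesis by simp
qed

end

section \<open>Counting embeddings that avoid special sets\<close>

context bounded_graph
begin

text \<open>Partial embeddings, defined on a growing part \<open>S\<close> of \<open>H\<close>;
  \<open>P\<close> stands for one side of \<open>H\<close>. That neither half of the image contains
  a special set is what limits the choices for the next vertex.\<close>

definition emb :: "graph \<Rightarrow> nat set \<Rightarrow> nat set \<Rightarrow> (nat \<Rightarrow> nat) set" where
  "emb H P S = {f \<in> S \<rightarrow>\<^sub>E V. inj_on f S \<and> (\<forall>x\<in>S. \<forall>y\<in>S. {x, y} \<in> edges H \<longrightarrow> {f x, f y} \<in> E) \<and>
     (\<forall>J. special J \<longrightarrow> \<not> J \<subseteq> f ` (S \<inter> P) \<and> \<not> J \<subseteq> f ` (S - P))}"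

lemma finite_emb: "finite S \<Longrightarrow> finite (emb H P S)"
  unfolding emb_def using finite_PiE[of S "\<lambda>_. V"] finV by simp

text \<open>Connectedness supplies a new vertex \<open>y\<close> with \<open>d \<ge> 1\<close>
  neighbours in \<open>S\<close>. Its image is a common neighbour of their images, which form no
  special set; so there are at most \<open>D ^ m / D ^ d\<close> choices, and exactly
  \<open>d\<close> edges are added.\<close>

lemma emb_partial_count:
  assumes wf: "wf_graph H" and cc: "cut_connected (edges H) (verts H)"
    and P: "\<And>x y. {x, y} \<in> edges H \<Longrightarrow> x \<in> P \<longleftrightarrow> y \<notin> P" and a: "a \<in> verts H"
    and n: "n < card (verts H)"
  shows "\<exists>S\<subseteq>verts H. a \<in> S \<and> card S = Suc n \<and>
    real (card {f \<in> emb H P S. f a = v}) * D ^ card {e \<in> edges H. e \<subseteq> S} \<le> (D ^ m) ^ n"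
  using n
proof (induction n)
  case 0
  have "\<not> e \<subseteq> {a}" if "e \<in> edges H" for e
  proof
    assume "e \<subseteq> {a}"
    then have "card e \<le> 1" using card_mono[of "{a}" e] by simp
    moreover have "card e = 2" using wf that unfolding wf_graph_def by blast
    ultimately show False by simp
  qed
  then have "{e \<in> edges H. e \<subseteq> {a}} = {}" by blast
  then have e: "card {e \<in> edges H. e \<subseteq> {a}} = 0" by simp
  have "{f \<in> emb H P {a}. f a = v} \<subseteq> {\<lambda>x\<in>{a}. v}"
    unfolding emb_def by (auto simp: PiE_def extensional_def restrict_def fun_eq_iff)
  then have "card {f \<in> emb H P {a}. f a = v} \<le> 1"
    using card_mono[of "{\<lambda>x\<in>{a}. v}"] by simp
  then have "real (card {f \<in> emb H P {a}. f a = v}) * D ^ card {e \<in> edges H. e \<subseteq> {a}} \<le> (D ^ m) ^ 0"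
    unfolding e by simp
  with a show ?case by (intro exI[of _ "{a}"] conjI) simp_all
next
  case (Suc n)
  then obtain S where S: "S \<subseteq> verts H" "a \<in> S" "card S = Suc n"
    "real (card {f \<in> emb H P S. f a = v}) * D ^ card {e \<in> edges H. e \<subseteq> S} \<le> (D ^ m) ^ n"
    by auto
  have finH: "finite (verts H)" using wf unfolding wf_graph_def by simp
  have finS: "finite S" using S finH finite_subset by blast
  have "S \<noteq> {}" "S \<noteq> verts H" using S Suc.prems by auto
  then obtain x y where xy: "x \<in> S" "y \<in> verts H - S" "{x, y} \<in> edges H"
    by (rule cut_connectedE[OF cc S(1)])
  define Nb where "Nb = {u\<in>S. {u, y} \<in> edges H}"
  have finNb: "finite Nb" using finS unfolding Nb_def by simp
  have xNb: "x \<in> Nb" using xy unfolding Nb_def by simp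
  have d1: "card Nb \<ge> 1" using xNb finNb by (metis One_nat_def Suc_leI card_gt_0_iff empty_iff)
  \<comment> \<open>All neighbours of \<open>y\<close> lie on the side opposite to \<open>y\<close>,
    so their image falls into one of the halves that contain no special set.\<close>
  have NbP: "Nb \<subseteq> S \<inter> P \<or> Nb \<subseteq> S - P" using P unfolding Nb_def by blast
  define FS where "FS = {f \<in> emb H P S. f a = v}"
  define FS' where "FS' = {f \<in> emb H P (insert y S). f a = v}"
  have finFS: "finite FS" using finite_emb[OF finS] unfolding FS_def by simp
  have cn: "real (card (common_nbr (g ` Nb))) * D ^ card Nb \<le> D ^ m" if g: "g \<in> FS" for g
  proof -
    have inj: "inj_on g Nb" using g unfolding FS_def emb_def Nb_def inj_on_def by blast
    have gV: "g ` Nb \<subseteq> V" using g unfolding FS_def emb_def Nb_def by auto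
    have cg: "card (g ` Nb) = card Nb" using card_image[OF inj] .
    show ?thesis
    \<comment> \<open>A single vertex is never special, but here the degree bound gives
      \<open>\<Delta> * D = D ^ m\<close>. Otherwise the failed inequality of \<open>special\<close>
      is multiplied by \<open>D\<close>.\<close>
    proof (cases "card Nb = 1")
      case True
      have "common_nbr (g ` Nb) \<subseteq> nbr (g x)" using xNb by (intro common_nbr_sub) auto
      then have "card (common_nbr (g ` Nb)) \<le> \<Delta>"
        using card_mono[OF fin_nbr] card_nbr le_trans by blast
      then show ?thesis unfolding True Dm using D_pos by simp
    next
      case False
      have "\<not> special (g ` Nb)"
      proof
        assume "special (g ` Nb)"
        then have "\<not> g ` Nb \<subseteq> g ` (S \<inter> P) \<and> \<not> g ` Nb \<subseteq> g ` (S - P)"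
          using g unfolding FS_def emb_def by blast
        then show False using NbP by blast
      qed
      then have "real (card (common_nbr (g ` Nb))) * D ^ (card Nb - 1) \<le> real \<Delta>"
        using False d1 gV cg unfolding special_def by auto
      then have "real (card (common_nbr (g ` Nb))) * D ^ (card Nb - 1) * D \<le> real \<Delta> * D"
        using D_pos by simp
      moreover have "D ^ card Nb = D ^ (card Nb - 1) * D"
        using d1 power_Suc2[of D "card Nb - 1"] by simp
      ultimately show ?thesis unfolding Dm by (simp add: mult.assoc)
    qed
  qed
  have inj: "inj_on (\<lambda>f. (restrict f S, f y)) FS'"
  proof (rule inj_onI)
    fix f g assume fg: "f \<in> FS'" "g \<in> FS'" "(restrict f S, f y) = (restrict g S, g y)"
    have "\<forall>z\<in>insert y S. f z = g z" using fg(3) by (metis Pair_inject insertE restrict_apply')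
    then show "f = g" using fg(1,2) unfolding FS'_def emb_def
      by (auto intro: PiE_ext[of _ "insert y S" "\<lambda>_. V"])
  qed
  have img: "(\<lambda>f. (restrict f S, f y)) ` FS' \<subseteq> (SIGMA g:FS. common_nbr (g ` Nb))"
  proof clarify
    fix f assume f: "f \<in> FS'"
    have im: "restrict f S ` X = f ` X" if "X \<subseteq> S" for X using that by auto
    have "inj_on f S" using f unfolding FS'_def emb_def by (auto intro: inj_on_subset)
    then have "inj_on (restrict f S) S" by (simp add: inj_on_restrict_eq)
    moreover have "\<not> J \<subseteq> restrict f S ` (S \<inter> P) \<and> \<not> J \<subseteq> restrict f S ` (S - P)" if "special J" for J
    proof -
      have "\<not> J \<subseteq> f ` (insert y S \<inter> P) \<and> \<not> J \<subseteq> f ` (insert y S - P)"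
        using f that unfolding FS'_def emb_def by blast
      moreover have "restrict f S ` (S \<inter> P) \<subseteq> f ` (insert y S \<inter> P)"
        "restrict f S ` (S - P) \<subseteq> f ` (insert y S - P)" by auto
      ultimately show ?thesis by (meson order.trans)
    qed
    ultimately have "restrict f S \<in> emb H P S"
      using f unfolding FS'_def emb_def by (auto simp: PiE_def Pi_def)
    then have "restrict f S \<in> FS" using f S(2) unfolding FS_def FS'_def by simp
    moreover have "f y \<in> common_nbr (restrict f S ` Nb)"
      using f im[of Nb] unfolding common_nbr_def FS'_def emb_def Nb_def by auto
    ultimately show "restrict f S \<in> FS \<and> f y \<in> common_nbr (restrict f S ` Nb)" by simp
  qed
  \<comment> \<open>This rests on \<open>x \<in> Nb\<close>: the common neighbourhood of the empty
    set would be infinite.\<close>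
  have fincn: "finite (common_nbr (g ` Nb))" for g
    using finite_subset[OF common_nbr_sub fin_nbr] xNb by blast
  have "card FS' \<le> card (SIGMA g:FS. common_nbr (g ` Nb))"
    using finFS fincn by (intro card_inj_on_le[OF inj img]) auto
  also have "\<dots> = (\<Sum>g\<in>FS. card (common_nbr (g ` Nb)))"
    using finFS fincn by simp
  finally have "real (card FS') \<le> (\<Sum>g\<in>FS. real (card (common_nbr (g ` Nb))))"
    by (metis of_nat_mono of_nat_sum)
  then have "real (card FS') * D ^ card Nb \<le> (\<Sum>g\<in>FS. real (card (common_nbr (g ` Nb)))) * D ^ card Nb"
    using D_pos by simp
  also have "\<dots> \<le> (\<Sum>g\<in>FS. D ^ m)" unfolding sum_distrib_right by (intro sum_mono cn)
  also have "\<dots> = real (card FS) * D ^ m" by simp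
  finally have 1: "real (card FS') * D ^ card Nb \<le> real (card FS) * D ^ m" .
  have "{e \<in> edges H. e \<subseteq> insert y S} = {e \<in> edges H. e \<subseteq> S} \<union> (\<lambda>u. {u, y}) ` Nb"
  proof (intro equalityI subsetI)
    fix e assume e: "e \<in> {e \<in> edges H. e \<subseteq> insert y S}"
    show "e \<in> {e \<in> edges H. e \<subseteq> S} \<union> (\<lambda>u. {u, y}) ` Nb"
    proof (cases "y \<in> e")
      case True
      have "card e = 2" using e wf unfolding wf_graph_def by blast
      then obtain u where "e = {u, y}" "u \<noteq> y" using True
        by (metis card_2_iff doubleton_eq_iff insert_iff singletonD)
      then show ?thesis using e unfolding Nb_def by auto
    next
      case False then show ?thesis using e by auto
    qed
  qed (auto simp: Nb_def)
  moreover have "card ((\<lambda>u. {u, y}) ` Nb) = card Nb"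
    by (intro card_image inj_onI) (auto simp: doubleton_eq_iff)
  moreover have "{e \<in> edges H. e \<subseteq> S} \<inter> (\<lambda>u. {u, y}) ` Nb = {}" using xy by auto
  moreover have "finite {e \<in> edges H. e \<subseteq> S}"
    by (rule finite_subset[of _ "Pow S"]) (auto simp: finS)
  ultimately have "card {e \<in> edges H. e \<subseteq> insert y S} = card {e \<in> edges H. e \<subseteq> S} + card Nb"
    using finNb by (simp add: card_Un_disjoint)
  then have "real (card FS') * D ^ card {e \<in> edges H. e \<subseteq> insert y S}
      = (real (card FS') * D ^ card Nb) * D ^ card {e \<in> edges H. e \<subseteq> S}" by (simp add: power_add mult_ac)
  also have "\<dots> \<le> (real (card FS) * D ^ m) * D ^ card {e \<in> edges H. e \<subseteq> S}"
    using 1 D_pos by (intro mult_right_mono) auto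
  also have "\<dots> = D ^ m * (real (card FS) * D ^ card {e \<in> edges H. e \<subseteq> S})" by simp
  also have "\<dots> \<le> D ^ m * (D ^ m) ^ n" using S(4) D_pos unfolding FS_def by (intro mult_left_mono) auto
  finally show ?case using S xy finS unfolding FS'_def by (intro exI[of _ "insert y S"]) auto
qed

lemma emb_count:
  assumes wf: "wf_graph H" and cc: "cut_connected (edges H) (verts H)"
    and P: "\<And>x y. {x, y} \<in> edges H \<Longrightarrow> x \<in> P \<longleftrightarrow> y \<notin> P" and a: "a \<in> verts H"
  shows "real (card {f \<in> emb H P (verts H). f a = v})
    \<le> (D ^ m) ^ (card (verts H) - 1) / D ^ card (edges H)"
proof -
  have fin: "finite (verts H)" using wf unfolding wf_graph_def by simp
  then have pos: "card (verts H) > 0" using a card_gt_0_iff by blast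
  obtain S where S: "S \<subseteq> verts H" "card S = Suc (card (verts H) - 1)"
    "real (card {f \<in> emb H P S. f a = v}) * D ^ card {e \<in> edges H. e \<subseteq> S} \<le> (D ^ m) ^ (card (verts H) - 1)"
    using emb_partial_count[OF wf cc P a, of "card (verts H) - 1"] pos by auto
  have "S = verts H" using card_subset_eq[OF fin S(1)] S(2) pos by simp
  moreover have "{e \<in> edges H. e \<subseteq> verts H} = edges H" using wf unfolding wf_graph_def by blast
  ultimately show ?thesis using S(3) D_pos by (simp add: pos_le_divide_eq)
qed

end

section \<open>Monochromatic pairs and sides of bipartite graphs\<close>

definition monochromatic :: "('a \<Rightarrow> 'b) \<Rightarrow> 'a set \<Rightarrow> bool" where
  "monochromatic \<phi> A \<longleftrightarrow> (\<forall>x\<in>A. \<forall>y\<in>A. \<phi> x = \<phi> y)"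

text \<open>One vertex other than \<open>v\<close> is kept in each nonempty set and gives the colour
  of that set; \<open>T\<close> consists of the rest. This is the condition \<open>det\<close> of
  \<open>rosenfeld_counting\<close>.\<close>

lemma constant_pair_determined:
  fixes A B :: "'a set"
  assumes fin: "finite A" "finite B" and dj: "A \<inter> B = {}" and cA: "2 \<le> card A"
    and cB: "B = {} \<or> 2 \<le> card B" and v: "v \<in> A \<union> B"
  shows "\<exists>T\<subseteq>A \<union> B - {v}. card T = (card A - 2) + (card B - 1) \<and>
    (\<forall>\<phi> \<psi> :: 'a \<Rightarrow> 'b. monochromatic \<phi> A \<and> monochromatic \<phi> B \<longrightarrow> monochromatic \<psi> A \<and> monochromatic \<psi> B \<longrightarrow>
      (\<forall>x\<in>A \<union> B - {v} - T. \<phi> x = \<psi> x) \<longrightarrow> (\<forall>x\<in>A \<union> B. \<phi> x = \<psi> x))"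
proof -
  have *: "\<exists>a\<in>X. a \<noteq> u" if "2 \<le> card X" for X :: "'a set" and u
  proof (rule ccontr)
    assume "\<not> ?thesis"
    then have "X \<subseteq> {u}" by blast
    then have "card X \<le> 1" using card_mono[of "{u}" X] by simp
    then show False using that by simp
  qed
  have core: "\<exists>T\<subseteq>A \<union> B - {v}. card T = n \<and>
    (\<forall>\<phi> \<psi> :: 'a \<Rightarrow> 'b. monochromatic \<phi> A \<and> monochromatic \<phi> B \<longrightarrow> monochromatic \<psi> A \<and> monochromatic \<psi> B \<longrightarrow>
      (\<forall>x\<in>A \<union> B - {v} - T. \<phi> x = \<psi> x) \<longrightarrow> (\<forall>x\<in>A \<union> B. \<phi> x = \<psi> x))"
    if K: "K \<subseteq> A \<union> B - {v}" "A \<inter> K \<noteq> {}" "B = {} \<or> B \<inter> K \<noteq> {}" "card (A \<union> B - {v} - K) = n" for K n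
  proof (intro exI[of _ "A \<union> B - {v} - K"] conjI allI impI ballI)
    fix \<phi> \<psi> :: "'a \<Rightarrow> 'b" and x
    assume a: "monochromatic \<phi> A \<and> monochromatic \<phi> B" "monochromatic \<psi> A \<and> monochromatic \<psi> B"
      "\<forall>x\<in>A \<union> B - {v} - (A \<union> B - {v} - K). \<phi> x = \<psi> x" "x \<in> A \<union> B"
    have ag: "\<phi> z = \<psi> z" if "z \<in> K" for z using a(3) that K(1) by blast
    have "\<exists>z\<in>K. \<phi> x = \<phi> z \<and> \<psi> x = \<psi> z"
    proof (cases "x \<in> A")
      case True
      then obtain z where "z \<in> A" "z \<in> K" using K(2) by blast
      then show ?thesis using True a(1,2) unfolding monochromatic_def by blast
    next
      case False
      then have xB: "x \<in> B" using a(4) by simp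
      then obtain z where "z \<in> B" "z \<in> K" using K(3) by blast
      then show ?thesis using xB a(1,2) unfolding monochromatic_def by blast
    qed
    then show "\<phi> x = \<psi> x" using ag by metis
  qed (use K(4) in auto)
  have cAB: "card (A \<union> B - {v}) = card A + card B - 1"
    using v fin dj by (simp add: card_Un_disjoint)
  obtain a where a: "a \<in> A" "a \<noteq> v" using *[OF cA] by blast
  show ?thesis
  proof (cases "B = {}")
    case True
    show ?thesis
    proof (rule core[of "{a}"])
      show "card (A \<union> B - {v} - {a}) = card A - 2 + (card B - 1)"
        using a cAB True cA fin by simp
    qed (use a True in auto)
  next
    case False
    then have cB2: "2 \<le> card B" using cB by simp
    obtain b where b: "b \<in> B" "b \<noteq> v" using *[OF cB2] by blast
    show ?thesis
    proof (rule core[of "{a, b}"])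
      have "a \<noteq> b" using a b dj by auto
      then have "card (A \<union> B - {v} - {a, b}) = card (A \<union> B - {v}) - 2"
        using a b by (subst card_Diff_subset) auto
      then show "card (A \<union> B - {v} - {a, b}) = card A - 2 + (card B - 1)"
        using cAB cA cB2 by simp
    qed (use a b in auto)
  qed
qed

lemma sum_union_le:
  fixes f :: "'a \<Rightarrow> real"
  assumes "finite A" "finite B" "\<And>x. f x \<ge> 0"
  shows "sum f (A \<union> B) \<le> sum f A + sum f B"
proof -
  have "sum f (A \<union> B) + sum f (A \<inter> B) = sum f A + sum f B"
    using sum.union_inter[OF assms(1,2)] .
  moreover have "sum f (A \<inter> B) \<ge> 0" using assms(3) by (intro sum_nonneg) auto
  ultimately show ?thesis by linarith
qed

text \<open>A fixed choice, so that every embedding of \<open>H\<close> determines one ordered pair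
  of vertex sets.\<close>

definition side :: "graph \<Rightarrow> nat set" where
  "side H = (SOME A. A \<subseteq> verts H \<and> (\<forall>e\<in>edges H. card (e \<inter> A) = 1))"

lemma side_edge:
  assumes "wf_graph H" "bipartite H" "{x, y} \<in> edges H"
  shows "x \<in> side H \<longleftrightarrow> y \<notin> side H"
proof -
  have "side H \<subseteq> verts H \<and> (\<forall>e\<in>edges H. card (e \<inter> side H) = 1)"
    using assms(2) unfolding bipartite_def side_def by (rule someI_ex)
  then have 1: "card ({x, y} \<inter> side H) = 1" using assms(3) by blast
  have "card {x, y} = 2" using assms(1,3) unfolding wf_graph_def by blast
  then have "x \<noteq> y" by auto
  then show ?thesis using 1 by (cases "x \<in> side H"; cases "y \<in> side H") auto
qed

section \<open>Weights of the constraints through a vertex\<close>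

context bounded_graph
begin

text \<open>A pair \<open>(A, B)\<close> is the constraint that \<open>A\<close> and \<open>B\<close> are not both monochromatic; for \<open>B = {}\<close>
  truncated subtraction gives the exponent \<open>card A - 2\<close>.\<close>

definition weight :: "real \<Rightarrow> nat set \<times> nat set \<Rightarrow> real" where
  "weight \<beta> = (\<lambda>(A, B). 1 / \<beta> ^ ((card A - 2) + (card B - 1)))"

definition edge_pairs :: "(nat set \<times> nat set) set" where
  "edge_pairs = (\<lambda>e. (e, {})) ` E"

definition special_pairs :: "(nat set \<times> nat set) set" where
  "special_pairs = (\<lambda>J. (J, {})) ` {J. special J}"

text \<open>Two vertices on each side are what \<open>constant_pair_determined\<close> asks for; the
  exponent of the weight is then \<open>card (verts H) - 3\<close>.\<close>

definition copies :: "graph \<Rightarrow> (nat \<Rightarrow> nat) set" where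
  "copies H = {f \<in> emb H (side H) (verts H). 2 \<le> card (verts H \<inter> side H) \<and> 2 \<le> card (verts H - side H)}"

definition copy_pairs :: "graph set \<Rightarrow> (nat set \<times> nat set) set" where
  "copy_pairs R = (\<lambda>(H, f). (f ` (verts H \<inter> side H), f ` (verts H - side H))) ` (SIGMA H:R. copies H)"

text \<open>These pairs deal with all graphs on more than \<open>n\<close> vertices at once.\<close>

definition tree_pairs :: "nat \<Rightarrow> (nat set \<times> nat set) set" where
  "tree_pairs n = {(A, B). bip_connected A B \<and> 2 \<le> card A \<and> 2 \<le> card B \<and> card (A \<union> B) = n + 1}"

lemma edge_pairs_sum:
  assumes "\<beta> > 0"
  shows "(\<Sum>c\<in>{c\<in>edge_pairs. v \<in> fst c \<union> snd c}. weight \<beta> c) \<le> real \<Delta>"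
proof -
  have "{c\<in>edge_pairs. v \<in> fst c \<union> snd c} = (\<lambda>u. ({v, u}, {})) ` nbr v" (is "?L = ?R")
  proof
    show "?L \<subseteq> ?R"
    proof
      fix c assume "c \<in> ?L"
      then obtain e where e: "e \<in> E" "c = (e, {})" "v \<in> e" unfolding edge_pairs_def by auto
      obtain u where "e = {v, u}" using E_2[OF e(1)] e(3) by (metis card_2_iff insertE insert_commute singletonD)
      then show "c \<in> ?R" using e unfolding nbr_def by auto
    qed
    show "?R \<subseteq> ?L" unfolding edge_pairs_def nbr_def by auto
  qed
  then have "(\<Sum>c\<in>?L. weight \<beta> c) = (\<Sum>c\<in>?R. weight \<beta> c)" by simp
  also have "\<dots> = (\<Sum>c\<in>?R. 1)"
  proof (rule sum.cong[OF refl])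
    fix c assume "c \<in> ?R"
    then obtain u where u: "c = ({v, u}, {})" "{v, u} \<in> E" unfolding nbr_def by auto
    show "weight \<beta> c = 1" using E_2[OF u(2)] unfolding weight_def u(1) by simp
  qed
  also have "\<dots> = real (card ?R)" by simp
  also have "\<dots> \<le> real \<Delta>"
    using order.trans[OF card_image_le[OF fin_nbr] card_nbr] by (intro of_nat_mono) blast
  finally show ?thesis .
qed

lemma special_pairs_sum:
  assumes "\<beta> \<ge> D ^ m"
  shows "(\<Sum>c\<in>{c\<in>special_pairs. v \<in> fst c \<union> snd c}. weight \<beta> c) \<le> 2 * D ^ m"
proof -
  have e: "{c\<in>special_pairs. v \<in> fst c \<union> snd c} = (\<lambda>J. (J, {})) ` {J. special J \<and> v \<in> J}"
    unfolding special_pairs_def by auto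
  have "(\<Sum>c\<in>{c\<in>special_pairs. v \<in> fst c \<union> snd c}. weight \<beta> c)
      = (\<Sum>J\<in>{J. special J \<and> v \<in> J}. 1 / \<beta> ^ (card J - 2))"
    unfolding e by (subst sum.reindex) (auto simp: inj_on_def weight_def)
  then show ?thesis using special_sum[OF assms] by simp
qed

lemma tree_pairs_sum:
  assumes "\<beta> > 0"
  shows "(\<Sum>c\<in>{c\<in>tree_pairs n. v \<in> fst c \<union> snd c}. weight \<beta> c)
    \<le> 2 * fact n * real \<Delta> ^ n / \<beta> ^ (n - 2)"
proof -
  have "{c\<in>tree_pairs n. v \<in> fst c \<union> snd c} =
     {(A, B). bip_connected A B \<and> 2 \<le> card A \<and> 2 \<le> card B \<and> card (A \<union> B) = n + 1 \<and> v \<in> A \<union> B}"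
    unfolding tree_pairs_def by auto
  then show ?thesis using bip_connected_sum[OF assms, of n v] unfolding weight_def by simp
qed

lemma finite_copies: "finite (verts H) \<Longrightarrow> finite (copies H)"
  unfolding copies_def using finite_emb by simp

text \<open>For a graph with \<open>h\<close> vertices and \<open>e\<close> edges, there are
  \<open>h\<close> choices for the vertex mapped to \<open>v\<close>, each leaving at most
  \<open>(D ^ m) ^ (h - 1) / D ^ e\<close> embeddings by \<open>emb_count\<close>, and each pair
  weighs at most \<open>1 / (D ^ m) ^ (h - 3)\<close>.\<close>

lemma copy_pairs_sum:
  assumes \<beta>: "\<beta> \<ge> D ^ m" and finR: "finite R"
    and R: "\<And>H. H \<in> R \<Longrightarrow> wf_graph H \<and> connected_graph H \<and> bipartite H"
  shows "(\<Sum>c\<in>{c\<in>copy_pairs R. v \<in> fst c \<union> snd c}. weight \<beta> c)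
    \<le> (\<Sum>H\<in>R. real (card (verts H)) * (D ^ m) ^ 2 / D ^ card (edges H))"
proof -
  define pr where "pr = (\<lambda>(H, f :: nat \<Rightarrow> nat). (f ` (verts H \<inter> side H), f ` (verts H - side H)))"
  define Cv where "Cv H = {f\<in>copies H. v \<in> f ` verts H}" for H
  have \<beta>0: "\<beta> > 0" using \<beta> Dm1 by linarith
  have finv: "finite (verts H)" if "H \<in> R" for H using R[OF that] unfolding wf_graph_def by simp
  have finCv: "finite (Cv H)" if "H \<in> R" for H
    using finite_copies[OF finv[OF that]] unfolding Cv_def by simp
  have eq: "{c\<in>copy_pairs R. v \<in> fst c \<union> snd c} = pr ` (SIGMA H:R. Cv H)"
  proof -
    have un: "fst (pr p) \<union> snd (pr p) = snd p ` verts (fst p)" for p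
      unfolding pr_def by (cases p) auto
    have "{c\<in>copy_pairs R. v \<in> fst c \<union> snd c} = pr ` {p \<in> Sigma R copies. v \<in> fst (pr p) \<union> snd (pr p)}"
      unfolding copy_pairs_def pr_def by blast
    also have "{p \<in> Sigma R copies. v \<in> fst (pr p) \<union> snd (pr p)} = (SIGMA H:R. Cv H)"
      unfolding un Cv_def by auto
    finally show ?thesis .
  qed
  have w0: "weight \<beta> c \<ge> 0" for c using \<beta>0 unfolding weight_def by (simp split: prod.split)
  \<comment> \<open>Only an inequality, because several embeddings can produce the same
    pair.\<close>
  have "(\<Sum>c\<in>pr ` (SIGMA H:R. Cv H). weight \<beta> c) \<le> (\<Sum>p\<in>(SIGMA H:R. Cv H). (weight \<beta> \<circ> pr) p)"
    using finCv finR w0 by (intro sum_image_le) auto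
  also have "\<dots> = (\<Sum>H\<in>R. \<Sum>f\<in>Cv H. weight \<beta> (pr (H, f)))"
    using finCv finR by (subst sum.Sigma) auto
  also have "\<dots> \<le> (\<Sum>H\<in>R. real (card (verts H)) * (D ^ m) ^ 2 / D ^ card (edges H))"
  proof (rule sum_mono)
    fix H assume H: "H \<in> R"
    have fv: "finite (verts H)" using finv[OF H] .
    define h where "h = card (verts H)"
    have hsum: "h = card (verts H \<inter> side H) + card (verts H - side H)"
      unfolding h_def using fv by (metis Int_Diff_Un Int_Diff_disjoint card_Un_disjoint finite_Diff finite_Int)
    show "(\<Sum>f\<in>Cv H. weight \<beta> (pr (H, f))) \<le> real (card (verts H)) * (D ^ m) ^ 2 / D ^ card (edges H)"
    \<comment> \<open>A nonempty \<open>Cv H\<close> shows that both sides of \<open>H\<close> have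
      two vertices, so that the subtraction in \<open>h - 3\<close> is not truncated.\<close>
    proof (cases "Cv H = {}")
      case True then show ?thesis using D_pos by simp
    next
      case False
      then have two: "2 \<le> card (verts H \<inter> side H)" "2 \<le> card (verts H - side H)"
        unfolding Cv_def copies_def by auto
      have wt: "weight \<beta> (pr (H, f)) \<le> 1 / (D ^ m) ^ (h - 3)" if f: "f \<in> Cv H" for f
      proof -
        have inj: "inj_on f (verts H)" using f unfolding Cv_def copies_def emb_def by simp
        have "card (f ` (verts H \<inter> side H)) = card (verts H \<inter> side H)"
          "card (f ` (verts H - side H)) = card (verts H - side H)"
          by (intro card_image inj_on_subset[OF inj]; blast)+
        then have "weight \<beta> (pr (H, f)) = 1 / \<beta> ^ (h - 3)"
          using two hsum unfolding weight_def pr_def by (simp add: numeral_3_eq_3)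
        also have "\<dots> \<le> 1 / (D ^ m) ^ (h - 3)"
          using \<beta> \<beta>0 D_pos by (intro divide_left_mono power_mono mult_pos_pos) auto
        finally show ?thesis .
      qed
      have "Cv H \<subseteq> (\<Union>a\<in>verts H. {f \<in> emb H (side H) (verts H). f a = v})"
        unfolding Cv_def copies_def by auto
      then have "card (Cv H) \<le> card (\<Union>a\<in>verts H. {f \<in> emb H (side H) (verts H). f a = v})"
        using fv finite_emb[OF fv] by (intro card_mono) auto
      also have "\<dots> \<le> (\<Sum>a\<in>verts H. card {f \<in> emb H (side H) (verts H). f a = v})"
        by (rule card_UN_le[OF fv])
      finally have "real (card (Cv H)) \<le> (\<Sum>a\<in>verts H. real (card {f \<in> emb H (side H) (verts H). f a = v}))"
        unfolding of_nat_sum[symmetric] of_nat_le_iff .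
      also have "\<dots> \<le> (\<Sum>a\<in>verts H. (D ^ m) ^ (h - 1) / D ^ card (edges H))"
        unfolding h_def
      proof (intro sum_mono emb_count)
        show "cut_connected (edges H) (verts H)" using R[OF H] cut_connected_graph by blast
        show "x \<in> side H \<longleftrightarrow> y \<notin> side H" if "{x, y} \<in> edges H" for x y
          using R[OF H] side_edge that by blast
      qed (use R[OF H] in auto)
      also have "\<dots> = real h * ((D ^ m) ^ (h - 1) / D ^ card (edges H))" unfolding h_def by simp
      finally have cC: "real (card (Cv H)) \<le> real h * ((D ^ m) ^ (h - 1) / D ^ card (edges H))" .
      have "(\<Sum>f\<in>Cv H. weight \<beta> (pr (H, f))) \<le> (\<Sum>f\<in>Cv H. 1 / (D ^ m) ^ (h - 3))"
        by (intro sum_mono wt)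
      also have "\<dots> = real (card (Cv H)) * (1 / (D ^ m) ^ (h - 3))" by simp
      also have "\<dots> \<le> (real h * ((D ^ m) ^ (h - 1) / D ^ card (edges H))) * (1 / (D ^ m) ^ (h - 3))"
        using cC D_pos by (intro mult_right_mono) auto
      also have "(D ^ m) ^ (h - 1) = (D ^ m) ^ 2 * (D ^ m) ^ (h - 3)"
        using two hsum by (subst power_add[symmetric]) (rule arg_cong[where f = "\<lambda>n. (D ^ m) ^ n"], simp)
      finally show ?thesis unfolding h_def using D_pos by simp
    qed
  qed
  finally show ?thesis unfolding eq .
qed

end

section \<open>Existence of the colouring\<close>

context bounded_graph
begin

text \<open>One common neighbour is enough, because the \<open>card B - 1 \<ge> m - 1\<close>
  factors \<open>D\<close> alone make up for \<open>\<Delta>\<close>.\<close>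

lemma special_if_star:
  assumes "B \<subseteq> V" "m \<le> card B" "\<And>b. b \<in> B \<Longrightarrow> {b, z} \<in> E"
  shows "special B"
proof -
  have "finite B" using assms(1) finV finite_subset by blast
  moreover have "B \<noteq> {}" using assms(2) m2 by auto
  ultimately obtain b where b: "b \<in> B" by blast
  have "z \<in> common_nbr B" using assms(3) unfolding common_nbr_def by blast
  moreover have "finite (common_nbr B)" using common_nbr_sub[OF b] fin_nbr finite_subset by blast
  ultimately have "card (common_nbr B) \<ge> 1" by (metis One_nat_def Suc_leI card_gt_0_iff empty_iff)
  then have c: "real (card (common_nbr B)) \<ge> 1" by simp
  have "real \<Delta> \<le> D ^ (card B - 1)"
    unfolding D_power[symmetric] using D1 assms(2) by (intro power_increasing) auto
  also have "\<dots> \<le> real (card (common_nbr B)) * D ^ (card B - 1)"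
    using c D_pos mult_right_mono[OF c, of "D ^ (card B - 1)"] by simp
  finally show ?thesis using assms m2 unfolding special_def by simp
qed

lemma constraints_wf:
  assumes R: "\<And>H. H \<in> R \<Longrightarrow> wf_graph H \<and> connected_graph H \<and> bipartite H"
    and c: "(A, B) \<in> edge_pairs \<union> special_pairs \<union> copy_pairs R \<union> tree_pairs n"
  shows "finite A \<and> finite B \<and> A \<inter> B = {} \<and> 2 \<le> card A \<and> (B = {} \<or> 2 \<le> card B) \<and> A \<union> B \<subseteq> V"
proof -
  have fV: "finite X" if "X \<subseteq> V" for X using that finV finite_subset by blast
  consider "(A, B) \<in> edge_pairs" | "(A, B) \<in> special_pairs" | "(A, B) \<in> copy_pairs R" | "(A, B) \<in> tree_pairs n"
    using c by blast
  then show ?thesis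
  proof cases
    case 1 then show ?thesis unfolding edge_pairs_def using E_V E_2 fV by auto
  next
    case 2 then show ?thesis unfolding special_pairs_def special_def using fV by auto
  next
    case 3
    then obtain H f where H: "H \<in> R" "f \<in> copies H"
      "A = f ` (verts H \<inter> side H)" "B = f ` (verts H - side H)"
      unfolding copy_pairs_def by auto
    have inj: "inj_on f (verts H)" and fVH: "f ` verts H \<subseteq> V"
      using H(2) unfolding copies_def emb_def by auto
    have "A \<inter> B = f ` ((verts H \<inter> side H) \<inter> (verts H - side H))"
      unfolding H(3,4) by (rule inj_on_image_Int[OF inj, symmetric]) auto
    then have "A \<inter> B = {}" by blast
    moreover have "card A = card (verts H \<inter> side H)" "card B = card (verts H - side H)"
      unfolding H(3,4) by (intro card_image inj_on_subset[OF inj]; blast)+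
    moreover have "A \<union> B \<subseteq> V" using fVH unfolding H(3,4) by blast
    ultimately show ?thesis using H(2) fV unfolding copies_def by auto
  next
    case 4 then show ?thesis unfolding tree_pairs_def bip_connected_def using fV by auto
  qed
qed

text \<open>If one colour class had at most one vertex, the other one would consist of at least \<open>m\<close>
  leaves of a star; such a set is special, because \<open>D ^ (m - 1) = \<Delta>\<close>, and monochromatic.\<close>

lemma no_star_class:
  assumes cc: "cut_connected E (A \<union> B)" and V: "A \<union> B \<subseteq> V"
    and proper: "\<And>x y. {x, y} \<in> E \<Longrightarrow> \<phi> x \<noteq> \<phi> y"
    and A: "\<And>x. x \<in> A \<Longrightarrow> \<phi> x = i" and B: "\<And>x. x \<in> B \<Longrightarrow> \<phi> x = j"
    and nospec: "\<And>J. special J \<Longrightarrow> \<not> monochromatic \<phi> J"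
    and cB: "m \<le> card B"
  shows "2 \<le> card A"
proof (rule ccontr)
  assume "\<not> ?thesis"
  then have cA: "card A \<le> 1" by simp
  have fA: "finite A" using V finV finite_subset by blast
  obtain z where z: "A \<subseteq> {z}"
    using cA fA by (metis card_le_Suc0_iff_eq One_nat_def empty_subsetI insertI1 subsetI singleton_iff subset_singleton_iff)
  \<comment> \<open>By connectedness \<open>b\<close> has a neighbour in
    \<open>A \<union> B\<close>, which properness keeps out of \<open>B\<close>; so it is
    \<open>z\<close>.\<close>
  have "{b, z} \<in> E" if b: "b \<in> B" for b
  proof -
    have "{b} \<noteq> A \<union> B"
    proof
      assume "{b} = A \<union> B"
      then have "B \<subseteq> {b}" by blast
      then have "card B \<le> 1" using card_mono[of "{b}" B] by simp
      then show False using cB m2 by simp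
    qed
    then obtain x y where xy: "x \<in> {b}" "y \<in> A \<union> B - {b}" "{x, y} \<in> E"
      using b by (auto intro: cut_connectedE[OF cc, of "{b}"])
    have "\<phi> x \<noteq> \<phi> y" using proper[OF xy(3)] .
    then have "y \<notin> B" using xy(1) B b by auto
    then show ?thesis using xy z by auto
  qed
  then have "special B" using special_if_star[of B z] V cB by auto
  moreover have "monochromatic \<phi> B" using B unfolding monochromatic_def by simp
  ultimately show False using nospec by blast
qed

text \<open>\<open>rosenfeld_counting\<close> with all four kinds of constraints yields the
  colouring. In a two-coloured copy on more than \<open>M\<close> vertices, \<open>M + 1\<close>
  connected vertices violate a tree pair. A smaller graph is first replaced by one from
  \<open>R\<close>, and a two-coloured copy of a graph in \<open>R\<close> on at most
  \<open>M\<close> vertices violates a copy pair. Colour classes too small for this are ruled out by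
  \<open>no_star_class\<close>.\<close>

lemma coloring_exists:
  fixes \<F> R :: "graph set" and M k :: nat and \<beta> :: real
  assumes \<beta>: "\<beta> \<ge> D ^ m"
    and \<F>: "\<forall>H\<in>\<F>. wf_graph H \<and> connected_graph H \<and> bipartite H \<and> m \<le> card (edges H)"
    and R: "R \<subseteq> \<F>" "finite R" and M: "m \<le> M"
    and reps: "\<And>H. H \<in> \<F> \<Longrightarrow> card (verts H) \<le> M \<Longrightarrow> \<exists>H'\<in>R. \<forall>G. contains_copy G H \<longrightarrow> contains_copy G H'"
    and k: "\<beta> + (real \<Delta> + 2 * D ^ m + (\<Sum>H\<in>R. real (card (verts H)) * (D ^ m) ^ 2 / D ^ card (edges H))
              + 2 * fact M * real \<Delta> ^ M / \<beta> ^ (M - 2)) \<le> real k"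
  shows "\<exists>c. two_F_coloring \<F> (V, E) c k"
proof -
  have \<beta>0: "\<beta> > 0" using \<beta> Dm1 by linarith
  have R': "wf_graph H \<and> connected_graph H \<and> bipartite H" if "H \<in> R" for H using that R \<F> by blast
  define I where "I = edge_pairs \<union> special_pairs \<union> copy_pairs R \<union> tree_pairs M"
  have Iwf: "finite A \<and> finite B \<and> A \<inter> B = {} \<and> 2 \<le> card A \<and> (B = {} \<or> 2 \<le> card B) \<and> A \<union> B \<subseteq> V"
    if "(A, B) \<in> I" for A B using constraints_wf[OF R'] that unfolding I_def by blast
  have finI: "finite I"
  proof (rule finite_subset)
    show "I \<subseteq> Pow V \<times> Pow V" using Iwf by auto
  qed (simp add: finV)
  have "\<exists>\<phi>. \<phi> ` V \<subseteq> {..<k} \<and> (\<forall>c\<in>I. fst c \<union> snd c \<subseteq> V \<longrightarrow>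
      \<not> (monochromatic \<phi> (fst c) \<and> monochromatic \<phi> (snd c)))"
  proof (rule rosenfeld_counting[where t = "\<lambda>c. (card (fst c) - 2) + (card (snd c) - 1)" and \<beta> = \<beta>])
    fix c assume "c \<in> I"
    then show "fst c \<union> snd c \<noteq> {}" using Iwf[of "fst c" "snd c"] by auto
  next
    fix c and \<phi> \<psi> :: "nat \<Rightarrow> nat"
    assume "monochromatic \<phi> (fst c) \<and> monochromatic \<phi> (snd c)"
      "\<And>x. x \<in> fst c \<union> snd c \<Longrightarrow> \<phi> x = \<psi> x"
    then show "monochromatic \<psi> (fst c) \<and> monochromatic \<psi> (snd c)"
      unfolding monochromatic_def by (metis UnI1 UnI2)
  next
    fix c v assume "c \<in> I" "v \<in> fst c \<union> snd c"
    then show "\<exists>T\<subseteq>fst c \<union> snd c - {v}. card T = (card (fst c) - 2) + (card (snd c) - 1) \<and>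
      (\<forall>\<phi> \<psi> :: nat \<Rightarrow> nat. monochromatic \<phi> (fst c) \<and> monochromatic \<phi> (snd c) \<longrightarrow>
        monochromatic \<psi> (fst c) \<and> monochromatic \<psi> (snd c) \<longrightarrow>
        (\<forall>x\<in>fst c \<union> snd c - {v} - T. \<phi> x = \<psi> x) \<longrightarrow> (\<forall>x\<in>fst c \<union> snd c. \<phi> x = \<psi> x))"
      using Iwf[of "fst c" "snd c"] by (intro constant_pair_determined) auto
  next
    fix v assume "v \<in> V"
    define w where "w X = (\<Sum>c\<in>{c\<in>X. v \<in> fst c \<union> snd c}. weight \<beta> c)" for X
    have w0: "weight \<beta> c \<ge> 0" for c using \<beta>0 unfolding weight_def by (simp split: prod.split)
    have fI: "finite edge_pairs" "finite special_pairs" "finite (copy_pairs R)" "finite (tree_pairs M)"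
      using finI unfolding I_def by auto
    have un: "w (X \<union> Y) \<le> w X + w Y" if "finite X" "finite Y" for X Y
    proof -
      have "{c \<in> X \<union> Y. v \<in> fst c \<union> snd c} = {c\<in>X. v \<in> fst c \<union> snd c} \<union> {c\<in>Y. v \<in> fst c \<union> snd c}" by blast
      then show ?thesis unfolding w_def using that w0 by (simp add: sum_union_le)
    qed
    have "w I \<le> w edge_pairs + w special_pairs + w (copy_pairs R) + w (tree_pairs M)"
      unfolding I_def using un[of edge_pairs special_pairs] un[of "edge_pairs \<union> special_pairs" "copy_pairs R"]
        un[of "edge_pairs \<union> special_pairs \<union> copy_pairs R" "tree_pairs M"] fI by simp
    also have "\<dots> \<le> real \<Delta> + 2 * D ^ m + (\<Sum>H\<in>R. real (card (verts H)) * (D ^ m) ^ 2 / D ^ card (edges H))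
              + 2 * fact M * real \<Delta> ^ M / \<beta> ^ (M - 2)"
      unfolding w_def using edge_pairs_sum[OF \<beta>0, of v] special_pairs_sum[OF \<beta>, of v]
        copy_pairs_sum[OF \<beta> R(2) R', of v] tree_pairs_sum[OF \<beta>0, of M v] by linarith
    finally have "\<beta> + w I \<le> real k" using k by linarith
    then show "\<beta> + (\<Sum>c\<in>{c\<in>I. v \<in> fst c \<union> snd c}. 1 / \<beta> ^ ((card (fst c) - 2) + (card (snd c) - 1))) \<le> real k"
      unfolding w_def weight_def by (simp add: case_prod_unfold)
  qed (use finV finI \<beta>0 in auto)
  then obtain \<phi> where \<phi>: "\<phi> ` V \<subseteq> {..<k}"
    and ok: "\<And>A B. (A, B) \<in> I \<Longrightarrow> \<not> (monochromatic \<phi> A \<and> monochromatic \<phi> B)"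
    using Iwf by (metis fst_conv snd_conv)
  have mono_empty: "monochromatic \<phi> {}" unfolding monochromatic_def by simp
  have proper: "\<phi> x \<noteq> \<phi> y" if "{x, y} \<in> E" for x y
  proof
    assume "\<phi> x = \<phi> y"
    then have "monochromatic \<phi> {x, y}" unfolding monochromatic_def by simp
    moreover have "({x, y}, {}) \<in> I" using that unfolding I_def edge_pairs_def by blast
    ultimately show False using ok mono_empty by blast
  qed
  have nospec: "\<not> monochromatic \<phi> J" if "special J" for J
    using ok[of J "{}"] mono_empty that unfolding I_def special_pairs_def by blast
  have no_copy: False
    if ij: "i \<noteq> j" and H: "H \<in> \<F>" and inj: "inj_on f (verts H)" and fV: "f ` verts H \<subseteq> V"
      and fE: "\<And>x y. {x, y} \<in> edges H \<Longrightarrow> {f x, f y} \<in> E"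
      and col: "\<And>x. x \<in> verts H \<Longrightarrow> \<phi> (f x) = i \<or> \<phi> (f x) = j"
      and cs: "M < card (verts H) \<or> H \<in> R" for i j H f
  proof -
    have gH: "wf_graph H" "connected_graph H" "bipartite H" "m \<le> card (edges H)" using H \<F> by auto
    have finH: "finite (verts H)" using gH unfolding wf_graph_def by simp
    have ccH: "cut_connected (edges H) (verts H)" using cut_connected_graph gH by blast
    have ccY: "cut_connected E (f ` verts H)" using cut_connected_image[OF ccH] fE by blast
    define cl where "cl S q = {y\<in>S. \<phi> y = q}" for S q
    have un: "cl S i \<union> cl S j = S" if "S \<subseteq> f ` verts H" for S using that col unfolding cl_def by blast
    have dj: "cl S i \<inter> cl S j = {}" for S using ij unfolding cl_def by auto
    have mono: "monochromatic \<phi> (cl S q)" for S q unfolding cl_def monochromatic_def by simp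
    \<comment> \<open>The assumptions \<open>c\<close> say that beside a class of at most one vertex
      the other one has at least \<open>m\<close>, so that \<open>no_star_class\<close>
      applies.\<close>
    have star: "2 \<le> card (cl S i) \<and> 2 \<le> card (cl S j)"
      if S: "S \<subseteq> f ` verts H" "cut_connected E S"
        and c: "card (cl S i) \<le> 1 \<Longrightarrow> m \<le> card (cl S j)" "card (cl S j) \<le> 1 \<Longrightarrow> m \<le> card (cl S i)" for S
    proof (rule ccontr)
      assume "\<not> ?thesis"
      then consider "card (cl S i) \<le> 1" | "card (cl S j) \<le> 1" by linarith
      then show False
      proof cases
        case 1
        have "2 \<le> card (cl S i)"
          by (rule no_star_class[of _ "cl S j" \<phi> i j])
            (use S fV un[OF S(1)] proper nospec c(1)[OF 1] in \<open>auto simp: cl_def\<close>)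
        then show False using 1 by simp
      next
        case 2
        have "2 \<le> card (cl S j)"
          by (rule no_star_class[of _ "cl S i" \<phi> j i])
            (use S fV un[OF S(1)] proper nospec c(2)[OF 2] in \<open>auto simp: cl_def Un_commute\<close>)
        then show False using 2 by simp
      qed
    qed
    show False
    proof (cases "M < card (verts H)")
      case True
      have "Suc M \<le> card (f ` verts H)" using True card_image[OF inj] by simp
      then obtain S where S: "S \<subseteq> f ` verts H" "card S = Suc M" "cut_connected E S"
        using cut_connected_subset[OF ccY] finH by blast
      have finS: "finite S" using S finH finite_subset by blast
      have "card (cl S i \<union> cl S j) = card (cl S i) + card (cl S j)"
        using finS dj by (intro card_Un_disjoint) (auto simp: cl_def)
      then have cS: "card (cl S i) + card (cl S j) = Suc M" using S un by simp
      have two: "2 \<le> card (cl S i) \<and> 2 \<le> card (cl S j)"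
        using star[OF S(1,3)] cS M by linarith
      \<comment> \<open>Properness puts the ends of every edge within \<open>S\<close> into
        different classes, so restricting to edges between the classes loses nothing.\<close>
      have "cut_connected {{x, y} | x y. x \<in> cl S i \<and> y \<in> cl S j \<and> {x, y} \<in> E} S"
      proof (rule cut_connected_mono[OF S(3)])
        fix x y assume xy: "x \<in> S" "y \<in> S" "{x, y} \<in> E"
        have "x \<in> cl S i \<union> cl S j" "y \<in> cl S i \<union> cl S j" using xy(1,2) un[OF S(1)] by simp_all
        then have "x \<in> cl S i \<and> y \<in> cl S j \<or> x \<in> cl S j \<and> y \<in> cl S i"
          using proper[OF xy(3)] unfolding cl_def by auto
        then obtain u w where uw: "u \<in> cl S i" "w \<in> cl S j" "{x, y} = {u, w}" by blast
        show "{x, y} \<in> {{x, y} | x y. x \<in> cl S i \<and> y \<in> cl S j \<and> {x, y} \<in> E}"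
          unfolding uw(3) using uw(1,2) xy(3)[unfolded uw(3)] by blast
      qed
      then have "bip_connected (cl S i) (cl S j)"
        using dj fV S(1) unfolding bip_connected_def un[OF S(1)] by auto
      then have "(cl S i, cl S j) \<in> I"
        using two S(2) un[OF S(1)] unfolding I_def tree_pairs_def by auto
      then show False using ok mono by blast
    next
      case False
      then have HR: "H \<in> R" using cs by simp
      define Y where "Y = f ` verts H"
      have cY: "card (cl Y i) + card (cl Y j) = card (verts H)"
      proof -
        have "card (cl Y i \<union> cl Y j) = card (cl Y i) + card (cl Y j)"
          using finH dj by (intro card_Un_disjoint) (auto simp: cl_def Y_def)
        then show ?thesis using un[of Y] card_image[OF inj] unfolding Y_def by simp
      qed
      \<comment> \<open>If a class has at most one vertex, all edges of \<open>H\<close> pass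
        through the vertex \<open>x0\<close> mapped there (any vertex if the class is empty). So
        \<open>H\<close> has at most \<open>card (verts H) - 1\<close> edges, but it has at least
        \<open>m\<close>.\<close>
      have small: "m \<le> card (verts H) - 1" if q: "{i, j} = {q, r}" "card (cl Y q) \<le> 1" for q r
      proof -
        have "finite (cl Y q)" using finH unfolding cl_def Y_def by simp
        then obtain x0 where x0: "x0 \<in> verts H" "cl Y q \<subseteq> {f x0}"
        proof (cases "cl Y q = {}")
          case True
          then show ?thesis using that gH(2) unfolding connected_graph_def by blast
        next
          case False
          then obtain x where "x \<in> verts H" "f x \<in> cl Y q" unfolding cl_def Y_def by auto
          moreover from this have "cl Y q \<subseteq> {f x}"
            using q(2) \<open>finite (cl Y q)\<close> card_le_Suc0_iff_eq by (metis One_nat_def singletonI subsetI)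
          ultimately show ?thesis using that by blast
        qed
        have "edges H \<subseteq> (\<lambda>u. {x0, u}) ` (verts H - {x0})"
        proof
          fix e assume e: "e \<in> edges H"
          then have "card e = 2" "e \<subseteq> verts H" using gH(1) unfolding wf_graph_def by auto
          then obtain x y where xy: "e = {x, y}" "x \<noteq> y" "x \<in> verts H" "y \<in> verts H"
            by (auto simp: card_2_iff)
          have "\<phi> (f x) \<noteq> \<phi> (f y)" using proper fE e xy by auto
          then have "\<phi> (f x) = q \<or> \<phi> (f y) = q" using col[OF xy(3)] col[OF xy(4)] q(1)
            by (auto simp: doubleton_eq_iff)
          then have "f x \<in> cl Y q \<or> f y \<in> cl Y q" using xy unfolding cl_def Y_def by auto
          then have "f x = f x0 \<or> f y = f x0" using x0 by auto
          then have "x = x0 \<or> y = x0" using inj xy x0 by (meson inj_onD)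
          then show "e \<in> (\<lambda>u. {x0, u}) ` (verts H - {x0})"
            using xy by (auto simp: insert_commute)
        qed
        then have "card (edges H) \<le> card (verts H - {x0})"
          using finH by (intro order.trans[OF card_mono card_image_le]) auto
        then show ?thesis using gH(4) x0 finH by simp
      qed
      have two: "2 \<le> card (cl Y i) \<and> 2 \<le> card (cl Y j)"
      proof (rule star)
        show "Y \<subseteq> f ` verts H" "cut_connected E Y" using ccY unfolding Y_def by auto
        show "m \<le> card (cl Y j)" if "card (cl Y i) \<le> 1"
          using small[OF refl that] cY that m2 by linarith
        show "m \<le> card (cl Y i)" if "card (cl Y j) \<le> 1"
          using small[OF insert_commute that] cY that m2 by linarith
      qed
      define X1 where "X1 = f ` (verts H \<inter> side H)"
      define X2 where "X2 = f ` (verts H - side H)"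
      obtain a where a: "a \<in> verts H" using gH(2) unfolding connected_graph_def by blast
      \<comment> \<open>The bipartition of a connected graph is unique up to exchanging the sides;
        \<open>c0\<close> records whether \<open>side H\<close> receives the colour
        \<open>i\<close>.\<close>
      define c0 where "c0 \<longleftrightarrow> (a \<in> side H \<longleftrightarrow> \<phi> (f a) = i)"
      have cls: "\<phi> (f x) = i \<longleftrightarrow> (x \<in> side H \<longleftrightarrow> c0)" if "x \<in> verts H" for x
      proof (rule cut_connected_induct[OF ccH a])
        show "\<phi> (f a) = i \<longleftrightarrow> (a \<in> side H \<longleftrightarrow> c0)" unfolding c0_def by blast
        fix x y assume xy: "x \<in> verts H" "y \<in> verts H" "{x, y} \<in> edges H" "\<phi> (f x) = i \<longleftrightarrow> (x \<in> side H \<longleftrightarrow> c0)"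
        have "\<phi> (f x) \<noteq> \<phi> (f y)" using proper fE xy(3) by blast
        then have "\<phi> (f x) = i \<longleftrightarrow> \<phi> (f y) \<noteq> i" using col xy(1,2) by metis
        moreover have "x \<in> side H \<longleftrightarrow> y \<notin> side H" using side_edge gH xy(3) by blast
        ultimately show "\<phi> (f y) = i \<longleftrightarrow> (y \<in> side H \<longleftrightarrow> c0)" using xy(4) by blast
      qed (use that in simp)
      have X: "X1 = cl Y i \<and> X2 = cl Y j \<or> X1 = cl Y j \<and> X2 = cl Y i"
      proof -
        have j: "\<phi> (f x) = j \<longleftrightarrow> \<phi> (f x) \<noteq> i" if "x \<in> verts H" for x using col[OF that] ij by auto
        show ?thesis using cls j unfolding X1_def X2_def Y_def cl_def by (cases c0) auto
      qed
      have cX: "card X1 = card (verts H \<inter> side H)" "card X2 = card (verts H - side H)"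
        unfolding X1_def X2_def by (intro card_image inj_on_subset[OF inj]; blast)+
      \<comment> \<open>\<open>emb\<close> consists of functions that are \<open>undefined\<close>
        outside \<open>verts H\<close>.\<close>
      define g where "g = restrict f (verts H)"
      have gX: "g ` (verts H \<inter> side H) = X1" "g ` (verts H - side H) = X2" unfolding g_def X1_def X2_def by auto
      have monoX: "monochromatic \<phi> X1" "monochromatic \<phi> X2" using X mono by auto
      have "inj_on g (verts H)" using inj unfolding g_def by (simp add: inj_on_restrict_eq)
      moreover have "\<not> J \<subseteq> X1 \<and> \<not> J \<subseteq> X2" if "special J" for J
        using nospec[OF that] monoX unfolding monochromatic_def by blast
      moreover have "g \<in> verts H \<rightarrow>\<^sub>E V" using fV unfolding g_def by auto
      moreover have "\<forall>x\<in>verts H. \<forall>y\<in>verts H. {x, y} \<in> edges H \<longrightarrow> {g x, g y} \<in> E"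
        using fE unfolding g_def by simp
      ultimately have "g \<in> emb H (side H) (verts H)" unfolding emb_def using gX by simp
      moreover have "2 \<le> card X1" "2 \<le> card X2" using X two by auto
      ultimately have "g \<in> copies H" unfolding copies_def using cX by simp
      then have "(X1, X2) \<in> copy_pairs R" unfolding copy_pairs_def using HR gX by force
      then show False using ok monoX unfolding I_def by blast
    qed
  qed
  have "two_F_coloring \<F> (V, E) \<phi> k"
    unfolding two_F_coloring_def
  proof (intro conjI allI impI ballI notI)
    show "proper_coloring (V, E) \<phi> k" unfolding proper_coloring_def
    proof (intro conjI ballI impI)
      show "\<phi> ` verts (V, E) \<subseteq> {..<k}" using \<phi> by (simp add: verts_def)
      fix e u v assume e: "e \<in> edges (V, E)" "u \<in> e" "v \<in> e" "u \<noteq> v"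
      then have "e \<in> E" by (simp add: edges_def)
      moreover from E_2[OF this] e have "e = {u, v}" by (auto simp: card_2_iff)
      ultimately show "\<phi> u \<noteq> \<phi> v" using proper by blast
    qed
    fix i j :: nat and H assume a: "i \<noteq> j" "H \<in> \<F>"
      "contains_copy (induced (V, E) {v \<in> verts (V, E). \<phi> v = i \<or> \<phi> v = j}) H"
    obtain H' where H': "H' \<in> \<F>" "M < card (verts H') \<or> H' \<in> R"
      "contains_copy (induced (V, E) {v \<in> verts (V, E). \<phi> v = i \<or> \<phi> v = j}) H'"
    proof (cases "M < card (verts H)")
      case True
      then show ?thesis using that[OF a(2)] a(3) by blast
    next
      case False
      then obtain H' where "H' \<in> R" "\<forall>G. contains_copy G H \<longrightarrow> contains_copy G H'"
        using reps[OF a(2)] by (auto simp: not_less)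
      then show ?thesis using that[of H'] a(3) R(1) by blast
    qed
    obtain f where f: "inj_on f (verts H')" "f ` verts H' \<subseteq> {v \<in> V. \<phi> v = i \<or> \<phi> v = j}"
      "\<And>e. e \<in> edges H' \<Longrightarrow> f ` e \<in> E"
      using H'(3) unfolding contains_copy_def induced_def verts_def edges_def by auto
    show False
      by (rule no_copy[OF a(1) H'(1) f(1) _ _ _ H'(2)]) (use f(2) f(3)[of "{_, _}"] in auto)
  qed
  then show ?thesis by blast
qed

end

subsection \<open>Isomorphism classes\<close>

text \<open>Well-formedness puts every edge within the vertex set, where the inverse bijection
  undoes \<open>f\<close>.\<close>

lemma graph_iso_sym:
  assumes "wf_graph H" "graph_iso H K"
  shows "graph_iso K H"
proof -
  obtain f where f: "bij_betw f (verts H) (verts K)" "(\<lambda>e. f ` e) ` edges H = edges K"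
    using assms(2) unfolding graph_iso_def by blast
  define g where "g = inv_into (verts H) f"
  have "g ` f ` e = e" if "e \<in> edges H" for e
  proof -
    have "e \<subseteq> verts H" using assms(1) that unfolding wf_graph_def by blast
    then show ?thesis unfolding g_def
      using f(1) by (simp add: bij_betw_def inv_into_image_cancel)
  qed
  then have "(\<lambda>e. g ` e) ` edges K = edges H"
    unfolding f(2)[symmetric] image_image by simp
  moreover have "bij_betw g (verts K) (verts H)" unfolding g_def using f(1) by (rule bij_betw_inv_into)
  ultimately show ?thesis unfolding graph_iso_def by blast
qed

lemma graph_iso_trans:
  assumes "graph_iso G H" "graph_iso H K"
  shows "graph_iso G K"
proof -
  obtain f g where f: "bij_betw f (verts G) (verts H)" "(\<lambda>e. f ` e) ` edges G = edges H"
    and g: "bij_betw g (verts H) (verts K)" "(\<lambda>e. g ` e) ` edges H = edges K"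
    using assms unfolding graph_iso_def by blast
  have "bij_betw (g \<circ> f) (verts G) (verts K)" using f(1) g(1) by (rule bij_betw_trans)
  moreover have "(\<lambda>e. (g \<circ> f) ` e) ` edges G = edges K"
    unfolding g(2)[symmetric] f(2)[symmetric] image_image image_comp[symmetric] ..
  ultimately show ?thesis unfolding graph_iso_def by blast
qed

lemma graph_iso_refl: "graph_iso H H"
  unfolding graph_iso_def by (intro exI[of _ id]) simp

lemma contains_copy_graph_iso:
  assumes "graph_iso K H" "contains_copy G H"
  shows "contains_copy G K"
proof -
  obtain f where f: "bij_betw f (verts K) (verts H)" "(\<lambda>e. f ` e) ` edges K = edges H"
    using assms(1) unfolding graph_iso_def by blast
  obtain g where g: "inj_on g (verts H)" "g ` verts H \<subseteq> verts G" "\<forall>e\<in>edges H. g ` e \<in> edges G"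
    using assms(2) unfolding contains_copy_def by blast
  have fK: "f ` verts K = verts H" "inj_on f (verts K)" using f(1) unfolding bij_betw_def by auto
  have "inj_on (g \<circ> f) (verts K)" using fK g(1) by (simp add: comp_inj_on)
  moreover have "(g \<circ> f) ` verts K \<subseteq> verts G" unfolding image_comp[symmetric] fK(1) by (rule g(2))
  moreover have "\<forall>e\<in>edges K. (g \<circ> f) ` e \<in> edges G"
    unfolding image_comp[symmetric] using f(2) g(3) by blast
  ultimately show ?thesis unfolding contains_copy_def by blast
qed

text \<open>Every class is determined by a graph on vertices below \<open>n\<close> to which its
  members are isomorphic, and there are finitely many such graphs.\<close>

lemma finite_iso_classes:
  assumes "\<And>H. H \<in> \<F> \<Longrightarrow> P H \<Longrightarrow> wf_graph H \<and> card (verts H) \<le> n"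
  shows "finite {C. \<exists>H\<in>\<F>. P H \<and> C = {H'\<in>\<F>. graph_iso H H'}}"
proof (rule finite_subset)
  show "{C. \<exists>H\<in>\<F>. P H \<and> C = {H'\<in>\<F>. graph_iso H H'}}
    \<subseteq> (\<lambda>K. {H'\<in>\<F>. graph_iso K H'}) ` (Pow {..<n} \<times> Pow (Pow {..<n}))"
  proof clarify
    fix A B assume H: "(A, B) \<in> \<F>" "P (A, B)"
    have wf: "wf_graph (A, B)" and c: "card (verts (A, B)) \<le> n" using assms[OF H] by auto
    have fin: "finite A" using wf unfolding wf_graph_def verts_def by simp
    obtain h where h: "bij_betw h A {0..<card A}" using ex_bij_betw_finite_nat[OF fin] by blast
    define K where "K = (h ` A, (\<lambda>e. h ` e) ` B)"
    have iso: "graph_iso (A, B) K"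
      unfolding graph_iso_def K_def verts_def edges_def
      using h by (intro exI[of _ h]) (auto simp: bij_betw_def)
    have hA: "h ` A \<subseteq> {..<n}" using h c unfolding bij_betw_def verts_def by auto
    moreover have "\<forall>e\<in>B. e \<subseteq> A" using wf unfolding wf_graph_def verts_def edges_def by simp
    ultimately have "K \<in> Pow {..<n} \<times> Pow (Pow {..<n})" unfolding K_def by auto
    moreover have "{H'\<in>\<F>. graph_iso (A, B) H'} = {H'\<in>\<F>. graph_iso K H'}"
      using graph_iso_trans[OF iso] graph_iso_trans[OF graph_iso_sym[OF wf iso]] by blast
    ultimately show "{H'\<in>\<F>. graph_iso (A, B) H'}
        \<in> (\<lambda>K. {H'\<in>\<F>. graph_iso K H'}) ` (Pow {..<n} \<times> Pow (Pow {..<n}))" by blast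
  qed
qed simp

text \<open>\<open>R\<close> takes one graph from each class. Finiteness of the set of classes makes
  \<open>count_iso\<close> a true count, as \<open>card\<close> of an infinite set would be
  0.\<close>

lemma iso_representatives:
  assumes "\<And>H. H \<in> \<F> \<Longrightarrow> P H \<Longrightarrow> wf_graph H \<and> card (verts H) \<le> n"
  obtains R where "R \<subseteq> {H\<in>\<F>. P H}" "finite R" "card R = count_iso \<F> P"
    "\<And>H. H \<in> \<F> \<Longrightarrow> P H \<Longrightarrow> \<exists>H'\<in>R. \<forall>G. contains_copy G H \<longrightarrow> contains_copy G H'"
proof -
  define cls where "cls H = {H'\<in>\<F>. graph_iso H H'}" for H
  have eq: "{C. \<exists>H\<in>\<F>. P H \<and> C = {H'\<in>\<F>. graph_iso H H'}} = cls ` {H\<in>\<F>. P H}"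
    unfolding cls_def by blast
  obtain R where R: "R \<subseteq> {H\<in>\<F>. P H}" "inj_on cls R" "cls ` {H\<in>\<F>. P H} = cls ` R"
    using subset_image_inj[of "cls ` {H\<in>\<F>. P H}" cls "{H\<in>\<F>. P H}"] by auto
  have "finite (cls ` R)" using finite_iso_classes[of \<F> P n] assms unfolding eq R(3) by blast
  then have "finite R" using R(2) by (simp add: finite_image_iff)
  moreover have "card R = count_iso \<F> P"
    unfolding count_iso_def eq R(3) using card_image[OF R(2)] by simp
  moreover have "\<exists>H'\<in>R. \<forall>G. contains_copy G H \<longrightarrow> contains_copy G H'" if H: "H \<in> \<F>" "P H" for H
  proof -
    obtain H' where H': "H' \<in> R" "cls H = cls H'" using R(3) H by blast
    have "H \<in> cls H" using H(1) graph_iso_refl unfolding cls_def by simp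
    then have "H \<in> cls H'" unfolding H'(2) .
    then show ?thesis using H'(1) contains_copy_graph_iso unfolding cls_def by blast
  qed
  ultimately show ?thesis using that R(1) by blast
qed

text \<open>As \<open>Y\<close> is grown from a single vertex, each new vertex brings at least one
  new edge.\<close>

lemma cut_connected_card_le:
  assumes cc: "cut_connected E Y" and fin: "finite Y"
  shows "card Y \<le> card {e\<in>E. e \<subseteq> Y} + 1"
proof (cases "card Y")
  case (Suc p)
  have "\<exists>S\<subseteq>Y. card S = Suc n \<and> n \<le> card {e\<in>E. e \<subseteq> S}" if "n \<le> p" for n
    using that
  proof (induction n)
    case 0
    obtain a where "a \<in> Y" using Suc by (metis card.empty ex_in_conv nat.distinct(1))
    then show ?case by (intro exI[of _ "{a}"]) auto
  next
    case (Suc n)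
    then obtain S where S: "S \<subseteq> Y" "card S = Suc n" "n \<le> card {e\<in>E. e \<subseteq> S}" by auto
    have finS: "finite S" using S fin finite_subset by blast
    have "S \<noteq> {}" "S \<noteq> Y" using S Suc.prems \<open>card Y = Suc p\<close> by auto
    then obtain x y where xy: "x \<in> S" "y \<in> Y - S" "{x, y} \<in> E"
      by (rule cut_connectedE[OF cc S(1)])
    have fE: "finite {e\<in>E. e \<subseteq> T}" if "finite T" for T
      by (rule finite_subset[of _ "Pow T"]) (use that in auto)
    have "{x, y} \<notin> {e\<in>E. e \<subseteq> S}" using xy by auto
    then have "Suc (card {e\<in>E. e \<subseteq> S}) = card (insert {x, y} {e\<in>E. e \<subseteq> S})"
      using fE[OF finS] by simp
    also have "\<dots> \<le> card {e\<in>E. e \<subseteq> insert y S}"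
      using fE[of "insert y S"] finS xy by (intro card_mono) auto
    finally have "Suc n \<le> card {e\<in>E. e \<subseteq> insert y S}" using S(3) by simp
    then show ?case using S xy finS by (intro exI[of _ "insert y S"]) auto
  qed
  from this[of p] obtain S where S: "S \<subseteq> Y" "card S = card Y" "p \<le> card {e\<in>E. e \<subseteq> S}"
    using Suc by auto
  have "S = Y" using card_subset_eq[OF fin S(1,2)] .
  then show ?thesis using S Suc by simp
qed simp

lemma verts_le_edges:
  assumes "wf_graph H" "connected_graph H"
  shows "card (verts H) \<le> card (edges H) + 1"
proof -
  have "{e\<in>edges H. e \<subseteq> verts H} = edges H" using assms(1) unfolding wf_graph_def by blast
  moreover have "finite (verts H)" using assms(1) unfolding wf_graph_def by simp
  ultimately show ?thesis using cut_connected_card_le[OF cut_connected_graph[OF assms]] by simp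
qed

subsection \<open>Numerical bounds\<close>

text \<open>The number of colours is the bound of \<open>coloring_exists\<close> rounded up, hence
  the strict inequality and the \<open>+ 1\<close>. It serves all graphs at once, so the supremum is
  finite.\<close>

lemma chi2F_Delta_less:
  fixes \<F> R :: "graph set" and m M \<Delta> :: nat and \<beta> D :: real
  assumes m: "m \<ge> 2" and D1: "D \<ge> 1" and D: "D ^ (m - 1) = real \<Delta>"
    and \<beta>: "\<beta> \<ge> D ^ m"
    and \<F>: "\<forall>H\<in>\<F>. wf_graph H \<and> connected_graph H \<and> bipartite H \<and> m \<le> card (edges H)"
    and R: "R \<subseteq> \<F>" "finite R" and M: "m \<le> M"
    and reps: "\<And>H. H \<in> \<F> \<Longrightarrow> card (verts H) \<le> M \<Longrightarrow> \<exists>H'\<in>R. \<forall>G. contains_copy G H \<longrightarrow> contains_copy G H'"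
  shows "chi2F_Delta \<F> \<Delta> \<noteq> \<infinity> \<and> real (the_enat (chi2F_Delta \<F> \<Delta>)) <
    \<beta> + (real \<Delta> + 2 * D ^ m + (\<Sum>H\<in>R. real (card (verts H)) * (D ^ m) ^ 2 / D ^ card (edges H))
              + 2 * fact M * real \<Delta> ^ M / \<beta> ^ (M - 2)) + 1" (is "_ \<and> _ < ?X + 1")
proof -
  define k where "k = nat \<lceil>?X\<rceil>"
  have "D ^ m \<ge> 1" using D1 by simp
  then have \<beta>0: "\<beta> > 0" using \<beta> by linarith
  have X0: "?X \<ge> 0" using \<beta>0 D1 by (intro add_nonneg_nonneg sum_nonneg) auto
  have kX: "?X \<le> real k" "real k < ?X + 1" unfolding k_def using X0 by linarith+
  have "chi2F \<F> G \<le> k" if G: "wf_graph G" "max_degree_le G \<Delta>" for G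
  proof -
    obtain V E where VE: "G = (V, E)" by (cases G)
    have fV: "finite V" and E: "\<forall>e\<in>E. e \<subseteq> V \<and> card e = 2"
      using G(1) unfolding wf_graph_def VE verts_def edges_def by auto
    have fE: "finite E" by (rule finite_subset[of _ "Pow V"]) (use E fV in auto)
    have dg: "card {u. {v, u} \<in> E} \<le> \<Delta>" if "v \<in> V" for v
    proof -
      have "card {u. {v, u} \<in> E} \<le> card {e\<in>E. v \<in> e}"
        by (rule card_inj_on_le[of "\<lambda>u. {v, u}"]) (auto simp: inj_on_def doubleton_eq_iff fE)
      also have "\<dots> \<le> \<Delta>"
        using G(2) that unfolding max_degree_le_def degree_def VE verts_def edges_def by simp
      finally show ?thesis .
    qed
    interpret bounded_graph V E \<Delta> D m
      by unfold_locales (use fV E dg D1 D m in auto)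
    have "\<exists>c. two_F_coloring \<F> (V, E) c k"
      by (rule coloring_exists[OF \<beta> \<F> R M reps kX(1)])
    then show ?thesis unfolding chi2F_def VE by (rule Least_le)
  qed
  then have le: "chi2F_Delta \<F> \<Delta> \<le> enat k"
    unfolding chi2F_Delta_def by (intro SUP_least) simp
  then obtain c where c: "chi2F_Delta \<F> \<Delta> = enat c" by (cases "chi2F_Delta \<F> \<Delta>") auto
  then show ?thesis using le kX(2) by simp
qed

text \<open>Beyond 2, the factors of \<open>fact n\<close> are \<open>n - 2\<close> numbers of size
  at most \<open>n\<close>.\<close>

lemma fact_le_power: "n \<ge> 2 \<Longrightarrow> fact n \<le> 2 * n ^ (n - 2)"
proof (induction n rule: nat_induct_at_least)
  case base then show ?case by (simp add: numeral_2_eq_2)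
next
  case (Suc n)
  have "fact (Suc n) \<le> Suc n * (2 * n ^ (n - 2))"
    unfolding fact_Suc of_nat_id using Suc(2) by (rule mult_left_mono) simp
  also have "\<dots> \<le> Suc n * (2 * Suc n ^ (n - 2))" by (intro mult_left_mono power_mono) auto
  also have "\<dots> = 2 * Suc n ^ Suc (n - 2)" by simp
  also have "Suc (n - 2) = Suc n - 2" using Suc by simp
  finally show ?case .
qed

theorem theorem12:
  fixes m :: nat and \<F> :: "graph set"
  assumes "m \<ge> 2"
    and "\<forall>H\<in>\<F>. wf_graph H \<and> connected_graph H \<and> bipartite H \<and> card (edges H) \<ge> m"
  shows "(\<forall>\<Delta>::nat. \<Delta> \<ge> 1 \<longrightarrow> chi2F_Delta \<F> \<Delta> \<noteq> \<infinity> \<and>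
            real (the_enat (chi2F_Delta \<F> \<Delta>))
              < (real (count_iso \<F> (\<lambda>H. card (verts H) \<le> m)) + 71) * (real m + 1)
                * real \<Delta> powr (real m / (real m - 1)))
     \<and> (\<exists>\<epsilon>::nat \<Rightarrow> real. \<epsilon> \<longlonglongrightarrow> 0 \<and>
          (\<forall>\<Delta>::nat. \<Delta> \<ge> 1 \<longrightarrow> chi2F_Delta \<F> \<Delta> \<noteq> \<infinity> \<and>
            real (the_enat (chi2F_Delta \<F> \<Delta>))
              < (real (count_iso \<F> (\<lambda>H. card (edges H) = m)) + 1 + \<epsilon> \<Delta>) * (real m + 1)
                * real \<Delta> powr (real m / (real m - 1))))"
proof -
  define D where "D \<Delta> = real \<Delta> powr (1 / (real m - 1))" for \<Delta> :: nat
  have D1: "D \<Delta> \<ge> 1" if "\<Delta> \<ge> 1" for \<Delta>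
    unfolding D_def using that assms(1) by (intro ge_one_powr_ge_zero) auto
  have D_pow: "D \<Delta> ^ (m - 1) = real \<Delta>" if "\<Delta> \<ge> 1" for \<Delta>
    unfolding D_def using that assms(1) by (simp add: powr_power of_nat_diff)
  have Q: "real \<Delta> powr (real m / (real m - 1)) = D \<Delta> ^ m" if "\<Delta> \<ge> 1" for \<Delta>
    unfolding D_def using that assms(1) by (simp add: powr_power)
  have \<Delta>D: "D \<Delta> ^ m = real \<Delta> * D \<Delta>" if "\<Delta> \<ge> 1" for \<Delta>
    using D_pow[OF that] assms(1) power_Suc2[of "D \<Delta>" "m - 1"] by simp
  have part1: "chi2F_Delta \<F> \<Delta> \<noteq> \<infinity> \<and> real (the_enat (chi2F_Delta \<F> \<Delta>))
      < (real (count_iso \<F> (\<lambda>H. card (verts H) \<le> m)) + 71) * (real m + 1)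
          * real \<Delta> powr (real m / (real m - 1))" if \<Delta>: "\<Delta> \<ge> 1" for \<Delta>
  proof -
    obtain R where R: "R \<subseteq> {H\<in>\<F>. card (verts H) \<le> m}" "finite R"
      "card R = count_iso \<F> (\<lambda>H. card (verts H) \<le> m)"
      "\<And>H. H \<in> \<F> \<Longrightarrow> card (verts H) \<le> m \<Longrightarrow> \<exists>H'\<in>R. \<forall>G. contains_copy G H \<longrightarrow> contains_copy G H'"
      by (rule iso_representatives[of \<F> "\<lambda>H. card (verts H) \<le> m" m]) (use assms(2) in auto)
    define d where "d = D \<Delta>"
    define q where "q = d ^ m"
    have d1: "d \<ge> 1" using D1[OF \<Delta>] unfolding d_def .
    have q1: "q \<ge> 1" using d1 unfolding q_def by simp
    have chi: "chi2F_Delta \<F> \<Delta> \<noteq> \<infinity> \<and> real (the_enat (chi2F_Delta \<F> \<Delta>)) <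
      real m * q + (real \<Delta> + 2 * d ^ m + (\<Sum>H\<in>R. real (card (verts H)) * (d ^ m) ^ 2 / d ^ card (edges H))
              + 2 * fact m * real \<Delta> ^ m / (real m * q) ^ (m - 2)) + 1"
    proof (rule chi2F_Delta_less)
      show "d ^ m \<le> real m * q" unfolding q_def[symmetric] using q1 assms(1) by simp
    qed (use assms R d1 D_pow[OF \<Delta>] in \<open>auto simp: d_def\<close>)
    have s1: "(\<Sum>H\<in>R. real (card (verts H)) * (d ^ m) ^ 2 / d ^ card (edges H)) \<le> (\<Sum>H\<in>R. real m * q)"
    proof (rule sum_mono)
      fix H assume "H \<in> R"
      then have H: "card (verts H) \<le> m" "m \<le> card (edges H)" using R(1) assms(2) by auto
      have "real (card (verts H)) * (d ^ m) ^ 2 / d ^ card (edges H) \<le> real m * q ^ 2 / d ^ m"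
        unfolding q_def using H d1 by (intro frac_le mult_right_mono power_increasing) auto
      also have "\<dots> = real m * q" unfolding q_def using d1 by (simp add: power2_eq_square)
      finally show "real (card (verts H)) * (d ^ m) ^ 2 / d ^ card (edges H) \<le> real m * q" .
    qed
    \<comment> \<open>From \<open>\<Delta> = d ^ (m - 1)\<close> follows
      \<open>\<Delta> ^ m = q ^ (m - 1)\<close>. The factor \<open>m\<close> in the choice
      \<open>m * q\<close> of \<open>\<beta>\<close> provides the power \<open>m ^ (m - 2)\<close>
      that absorbs \<open>fact m\<close>.\<close>
    have s2: "2 * fact m * real \<Delta> ^ m / (real m * q) ^ (m - 2) \<le> 4 * q"
    proof -
      have "real \<Delta> ^ m = q ^ (m - 1)"
        unfolding q_def D_pow[OF \<Delta>, symmetric] d_def by (simp add: power_mult[symmetric] mult.commute)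
      also have "\<dots> = q * q ^ (m - 2)" using assms(1) power_Suc[of q "m - 2"]
        by (metis Suc_1 Suc_diff_le diff_Suc_Suc)
      finally have e: "2 * fact m * real \<Delta> ^ m / (real m * q) ^ (m - 2)
          = (2 * fact m / real m ^ (m - 2)) * q"
        using q1 by (simp add: power_mult_distrib)
      have "real (fact m) \<le> real (2 * m ^ (m - 2))"
        using fact_le_power[OF assms(1)] by (rule of_nat_mono)
      then have "2 * fact m / real m ^ (m - 2) \<le> (4 :: real)"
        using assms(1) by (simp add: pos_divide_le_eq)
      then show ?thesis unfolding e using q1 by (intro mult_right_mono) auto
    qed
    have s3: "real \<Delta> \<le> q" unfolding q_def d_def \<Delta>D[OF \<Delta>]
      using mult_left_mono[OF D1[OF \<Delta>], of "real \<Delta>"] by simp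
    have "real (the_enat (chi2F_Delta \<F> \<Delta>))
        < real m * q + (q + 2 * q + real (card R) * (real m * q) + 4 * q) + q"
      using chi s1 s2 s3 q1 unfolding q_def[symmetric] sum_constant by linarith
    \<comment> \<open>The 8 consists of 1 for the edges, 2 for the special sets, 4 for the large
      sets and 1 for rounding up; \<open>m + 8\<close> is within the allowed
      \<open>71 * (m + 1)\<close>.\<close>
    also have "\<dots> = (real m + 8 + real (card R) * real m) * q" by (simp add: algebra_simps)
    also have "\<dots> \<le> ((real (card R) + 71) * (real m + 1)) * q"
      using q1 by (intro mult_right_mono) (auto simp: algebra_simps)
    finally show ?thesis using chi Q[OF \<Delta>] R(3) unfolding q_def d_def by simp
  qed
  \<comment> \<open>Connected graphs with \<open>m\<close> edges have at most \<open>m + 1\<close>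
    vertices, so they form finitely many classes. Of the family, only they contribute to the leading
    term.\<close>
  obtain R1 where R1: "R1 \<subseteq> {H\<in>\<F>. card (edges H) = m}" "finite R1"
    "card R1 = count_iso \<F> (\<lambda>H. card (edges H) = m)"
    "\<And>H. H \<in> \<F> \<Longrightarrow> card (edges H) = m \<Longrightarrow> \<exists>H'\<in>R1. \<forall>G. contains_copy G H \<longrightarrow> contains_copy G H'"
    by (rule iso_representatives[of \<F> "\<lambda>H. card (edges H) = m" "m + 1"])
      (use assms(2) verts_le_edges in \<open>force+\<close>)
  \<comment> \<open>The additional edge of these graphs saves another factor \<open>D\<close>, which
    puts them into the error term.\<close>
  obtain R2 where R2: "R2 \<subseteq> {H\<in>\<F>. m < card (edges H) \<and> card (verts H) \<le> m + 1}" "finite R2"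
    "\<And>H. H \<in> \<F> \<Longrightarrow> m < card (edges H) \<and> card (verts H) \<le> m + 1 \<Longrightarrow>
      \<exists>H'\<in>R2. \<forall>G. contains_copy G H \<longrightarrow> contains_copy G H'"
    by (rule iso_representatives[of \<F> "\<lambda>H. m < card (edges H) \<and> card (verts H) \<le> m + 1" "m + 1"])
      (use assms(2) in auto)
  \<comment> \<open>\<open>K\<close> collects what is of order \<open>\<Delta> = q / d\<close>: 1
    for the edges and 1 for rounding up, then the graphs in \<open>R2\<close> and the large sets.
    Relative to \<open>q\<close> this is \<open>K / d\<close>, hence
    \<open>\<epsilon>\<close>.\<close>
  define K where "K = 2 + real (card R2) * (real m + 1) + 2 * fact (m + 1)"
  define \<epsilon> where "\<epsilon> \<Delta> = K * real \<Delta> powr (- (1 / (real m - 1)))" for \<Delta> :: nat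
  have "(\<lambda>\<Delta>. real \<Delta> powr (- (1 / (real m - 1)))) \<longlonglongrightarrow> 0"
    using assms(1) by (intro tendsto_neg_powr filterlim_real_sequentially) auto
  then have lim: "\<epsilon> \<longlonglongrightarrow> 0" unfolding \<epsilon>_def by (rule tendsto_mult_right_zero)
  have part2: "chi2F_Delta \<F> \<Delta> \<noteq> \<infinity> \<and> real (the_enat (chi2F_Delta \<F> \<Delta>))
      < (real (count_iso \<F> (\<lambda>H. card (edges H) = m)) + 1 + \<epsilon> \<Delta>) * (real m + 1)
          * real \<Delta> powr (real m / (real m - 1))" if \<Delta>: "\<Delta> \<ge> 1" for \<Delta>
  proof -
    define d where "d = D \<Delta>"
    define q where "q = d ^ m"
    define F where "F H = real (card (verts H)) * (d ^ m) ^ 2 / d ^ card (edges H)" for H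
    have d1: "d \<ge> 1" using D1[OF \<Delta>] unfolding d_def .
    have q1: "q \<ge> 1" using d1 unfolding q_def by simp
    have qd: "real \<Delta> = q / d" unfolding q_def d_def \<Delta>D[OF \<Delta>] using D1[OF \<Delta>] by simp
    have dj: "R1 \<inter> R2 = {}" using R1(1) R2(1) by auto
    have chi: "chi2F_Delta \<F> \<Delta> \<noteq> \<infinity> \<and> real (the_enat (chi2F_Delta \<F> \<Delta>)) <
      d ^ m + (real \<Delta> + 2 * d ^ m + (\<Sum>H\<in>R1 \<union> R2. real (card (verts H)) * (d ^ m) ^ 2 / d ^ card (edges H))
              + 2 * fact (m + 1) * real \<Delta> ^ (m + 1) / (d ^ m) ^ (m + 1 - 2)) + 1"
    proof (rule chi2F_Delta_less)
      fix H assume H: "H \<in> \<F>" "card (verts H) \<le> m + 1"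
      then have "m \<le> card (edges H)" using assms(2) by auto
      then consider "card (edges H) = m" | "m < card (edges H)" by linarith
      then show "\<exists>H'\<in>R1 \<union> R2. \<forall>G. contains_copy G H \<longrightarrow> contains_copy G H'"
        using R1(4)[OF H(1)] R2(3)[OF H(1)] H(2) by cases blast+
    qed (use assms R1(1,2) R2(1,2) d1 D_pow[OF \<Delta>] in \<open>auto simp: d_def\<close>)
    have s1: "F H \<le> (real m + 1) * q" if "H \<in> R1" for H
    proof -
      have H: "card (edges H) = m" "card (verts H) \<le> m + 1"
        using that R1(1) assms(2) verts_le_edges[of H] by auto
      have "F H \<le> (real m + 1) * q ^ 2 / d ^ m"
        unfolding F_def q_def H(1) using H(2) d1 by (intro divide_right_mono mult_right_mono) auto
      also have "\<dots> = (real m + 1) * q" unfolding q_def using d1 by (simp add: power2_eq_square)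
      finally show ?thesis .
    qed
    have s2: "F H \<le> (real m + 1) * (q / d)" if "H \<in> R2" for H
    proof -
      have H: "m + 1 \<le> card (edges H)" "card (verts H) \<le> m + 1" using that R2(1) by auto
      have "F H \<le> (real m + 1) * q ^ 2 / d ^ (m + 1)"
        unfolding F_def q_def using H d1 by (intro frac_le mult_right_mono power_increasing) auto
      also have "\<dots> = (real m + 1) * (q / d)" unfolding q_def using d1 by (simp add: power2_eq_square)
      finally show ?thesis .
    qed
    have "(\<Sum>H\<in>R1 \<union> R2. F H) = sum F R1 + sum F R2"
      using R1(2) R2(2) dj by (rule sum.union_disjoint)
    also have "\<dots> \<le> (\<Sum>H\<in>R1. (real m + 1) * q) + (\<Sum>H\<in>R2. (real m + 1) * (q / d))"
      using s1 s2 by (intro add_mono sum_mono) auto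
    finally have s: "(\<Sum>H\<in>R1 \<union> R2. F H) \<le> real (card R1) * ((real m + 1) * q) + real (card R2) * ((real m + 1) * (q / d))"
      by simp
    \<comment> \<open>The exponent is split to give
      \<open>\<Delta> ^ (m + 1) = \<Delta> * q ^ (m - 1)\<close>; the power of \<open>q\<close>
      cancels against that of \<open>\<beta>\<close>, and \<open>\<Delta> = q / d\<close>
      remains.\<close>
    have "real \<Delta> ^ (m + 1) = d ^ ((m - 1) * (m + 1))"
      unfolding D_pow[OF \<Delta>, symmetric] d_def by (simp only: power_mult)
    also have "(m - 1) * (m + 1) = (m - 1) + m * (m - 1)"
      by (simp only: distrib_left mult_1_right add.commute mult.commute)
    also have "d ^ \<dots> = (q / d) * q ^ (m - 1)"
      using D_pow[OF \<Delta>] qd unfolding power_add power_mult q_def d_def by simp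
    finally have t: "2 * fact (m + 1) * real \<Delta> ^ (m + 1) / (d ^ m) ^ (m + 1 - 2) = 2 * fact (m + 1) * (q / d)"
      unfolding q_def[symmetric] using q1 by simp
    have one: "1 \<le> q / d" using \<Delta> qd by simp
    have "real (the_enat (chi2F_Delta \<F> \<Delta>)) <
      q + (q / d + 2 * q + (real (card R1) * ((real m + 1) * q) + real (card R2) * ((real m + 1) * (q / d)))
        + 2 * fact (m + 1) * (q / d)) + q / d"
      using chi s one unfolding t unfolding F_def[abs_def] q_def[symmetric] qd by linarith
    also have "\<dots> = 3 * q + real (card R1) * (real m + 1) * q + K * (q / d)"
      unfolding K_def by (simp add: algebra_simps)
    \<comment> \<open>The 3 is 1 from \<open>\<beta>\<close> and 2 from the special sets;
      \<open>m \<ge> 2\<close> makes it at most \<open>m + 1\<close>, which is the constant 1 in the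
      first factor of the bound.\<close>
    also have "\<dots> \<le> (real m + 1) * q + real (card R1) * (real m + 1) * q + (K * (q / d)) * (real m + 1)"
    proof -
      have "K \<ge> 0" unfolding K_def by simp
      then have "K * (q / d) \<ge> 0" using q1 d1 by simp
      then have "(K * (q / d)) * 1 \<le> (K * (q / d)) * (real m + 1)" by (intro mult_left_mono) auto
      moreover have "3 * q \<le> (real m + 1) * q" using q1 assms(1) by (intro mult_right_mono) auto
      ultimately show ?thesis by linarith
    qed
    also have "\<dots> = (real (card R1) + 1 + K / d) * (real m + 1) * q"
      by (simp add: algebra_simps add_divide_distrib)
    also have "K / d = \<epsilon> \<Delta>" unfolding \<epsilon>_def d_def D_def by (simp add: powr_minus_divide)
    finally show ?thesis using chi Q[OF \<Delta>] R1(3) unfolding q_def d_def by simp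
  qed
  show ?thesis using part1 part2 lim by blast
qed

end
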